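(* Let $\alpha,\beta,\gamma,\rho,a\in\mathbb{C}$ with $a\ne0$, and let $\mu$ be a real number, such that $\operatorname{Re}(\alpha)>0$, $\mu>0$ and $\operatorname{Re}(\rho)>\max\{0,\operatorname{Re}(\beta-\gamma)\}$. Then for every $x>0$, $$\left(\mathcal{I}_{0+}^{\alpha,\beta,\gamma}\left(t^{\rho-1}I^{m,n}_{p,q}\left[at^{\mu}\,\middle|\begin{matrix}(a_i,A_i,\alpha_i)_{1,p}\\(b_j,B_j,\beta_j)_{1,q}\end{matrix}\right]\right)\right)(x)=x^{-\beta+\rho-1}\,I^{m,n+2}_{p+2,q+2}\left[ax^{\mu}\,\middle|\begin{matrix}(1-\rho,\mu,1),\ (1+\beta-\gamma-\rho,\mu,1),\ (a_i,A_i,\alpha_i)_{1,p}\\(b_j,B_j,\beta_j)_{1,q},\ (1+\beta-\rho,\mu,1),\ (1-\alpha-\gamma-\rho,\mu,1)\end{matrix}\right].$$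
   Context: **$I$-function.** Let $m,n,p,q$ be integers with $0\le m\le q$, $0\le n\le p$; let $a_i\in\mathbb{C}$, $A_i,\alpha_i>0$ $(1\le i\le p)$ and $b_j\in\mathbb{C}$, $B_j,\beta_j>0$ $(1\le j\le q)$. For $z\neq0$ (with a chosen value of $\arg z$; $z^{-s}=e^{-s(\log|z|+i\arg z)}$), $$I^{m,n}_{p,q}\left[z\,\middle|\begin{matrix}(a_i,A_i,\alpha_i)_{1,p}\\(b_j,B_j,\beta_j)_{1,q}\end{matrix}\right]=\frac{1}{2\pi i}\int_{C}\chi(s)z^{-s}\,ds,\qquad \chi(s)=\frac{\prod_{j=1}^{m}\Gamma^{\beta_j}(b_j+B_js)\prod_{i=1}^{n}\Gamma^{\alpha_i}(1-a_i-A_is)}{\prod_{j=m+1}^{q}\Gamma^{\beta_j}(1-b_j-B_js)\prod_{i=n+1}^{p}\Gamma^{\alpha_i}(a_i+A_is)}.$$ Here $(a_i,A_i,\alpha_i)_{1,p}$ is the ordered list of triples for $i=1,\dots,p$ (the first $n$ upper triples and the first $m$ lower triples enter the numerator), $\Gamma^{\kappa}(w)=(\Gamma(w))^{\kappa}$, with the branch of non-integer powers fixed along $C$ and the same for the same triple in all $I$-functions considered; empty products equal $1$. The singularities of $\Gamma^{\beta_j}(b_j+B_js)$, $j\le m$, lie to the left of $C$ and those of $\Gamma^{\alpha_i}(1-a_i-A_is)$, $i\le n$, to the right. **Standing assumptions.** The contour $C$ is the imaginary axis $\operatorname{Re}(s)=0$, traversed upwards, and for each $I$-function occurring the following conditions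 for absolute convergence hold: with (computed from the parameters of that $I$-function) $\mu^*=\sum_{j=1}^q\beta_jB_j-\sum_{i=1}^p\alpha_iA_i$, $\Omega=\sum_{i=1}^p(\frac12-\operatorname{Re}(a_i))\alpha_i-\sum_{j=1}^q(\frac12-\operatorname{Re}(b_j))\beta_j$, $\Delta=\sum_{j=1}^m\beta_jB_j-\sum_{j=m+1}^q\beta_jB_j+\sum_{i=1}^n\alpha_iA_i-\sum_{i=n+1}^p\alpha_iA_i$, either $\Delta>0$ and $|\arg z|<\frac{\pi}{2}\Delta$, or $\Delta\ge0$, $|\arg z|=\frac{\pi}{2}\Delta$ and one of: $\mu^*=0$ and $\Omega<-1$; or $\mu^*\ne0$ and $\Omega+\sigma\mu^*<-1$ where $\sigma=\operatorname{Re}(s)$ on $C$ (so $\sigma=0$). For $t>0$, $\arg(at^{\pm\mu})=\arg a$. **Operator.** For $\operatorname{Re}(\alpha)>0$, $x>0$, the left-sided Saigo (generalized) fractional integral is $$\left(\mathcal{I}_{0+}^{\alpha,\beta,\gamma}f\right)(x)=\frac{x^{-\alpha-\beta}}{\Gamma(\alpha)}\int_0^x(x-t)^{\alpha-1}{}_{2}F_1\left(\alpha+\beta,-\gamma;\alpha;1-\tfrac{t}{x}\right)f(t)\,dt.$$ *)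

theory Defs
  imports "HOL-Analysis.Analysis"
begin

text \<open>
  An upper triple \<open>(a\<^sub>i, A\<^sub>i, \<alpha>\<^sub>i)\<close> or a lower triple \<open>(b\<^sub>j, B\<^sub>j, \<beta>\<^sub>j)\<close>. Parameter lists are ordered,
  and \<open>p\<close> and \<open>q\<close> are their lengths.
\<close>

type_synonym triple = "complex \<times> real \<times> real"

text \<open>
  The branch of \<open>\<Gamma>(c + d s)\<^sup>\<kappa>\<close> along the contour \<open>Re s = 0\<close> is given by a continuous logarithm
  \<open>\<Lambda> c d \<kappa>\<close> of \<open>s \<mapsto> \<Gamma>(c + d s)\<close> there. For \<open>d \<noteq> 0\<close> at most one point of the contour is a pole
  of \<open>\<Gamma>(c + d s)\<close> and has to be left out. Keying \<open>\<Lambda>\<close> by \<open>c\<close>, \<open>d\<close>, \<open>\<kappa>\<close> makes the branch depend on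
  the triple alone, so that it is shared by all \<open>I\<close>-functions built from the same \<open>\<Lambda>\<close>.
\<close>

type_synonym branch = "complex \<Rightarrow> real \<Rightarrow> real \<Rightarrow> complex \<Rightarrow> complex"

definition gamma_branch :: "branch \<Rightarrow> bool" where
  "gamma_branch \<Lambda> \<longleftrightarrow> (\<forall>c d \<kappa>.
     continuous_on {s. Re s = 0 \<and> c + of_real d * s \<notin> \<int>\<^sub>\<le>\<^sub>0} (\<Lambda> c d \<kappa>) \<and>
     (\<forall>s. Re s = 0 \<and> c + of_real d * s \<notin> \<int>\<^sub>\<le>\<^sub>0 \<longrightarrow> exp (\<Lambda> c d \<kappa> s) = Gamma (c + of_real d * s)))"

text \<open>
  At a pole the value is \<open>0\<close>, as for \<^const>\<open>Gamma\<close>. This only matters for the factors in the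
  denominator of \<open>\<chi>\<close>, and there \<open>x / 0 = 0\<close> gives the correct value \<open>1 / \<Gamma>\<^sup>\<kappa> = 0\<close>.
\<close>

definition Gamma_pow :: "branch \<Rightarrow> complex \<Rightarrow> real \<Rightarrow> real \<Rightarrow> complex \<Rightarrow> complex" where
  "Gamma_pow \<Lambda> c d \<kappa> s =
     (if c + of_real d * s \<in> \<int>\<^sub>\<le>\<^sub>0 then 0 else exp (of_real \<kappa> * \<Lambda> c d \<kappa> s))"

definition I_chi :: "branch \<Rightarrow> nat \<Rightarrow> nat \<Rightarrow> triple list \<Rightarrow> triple list \<Rightarrow> complex \<Rightarrow> complex" where
  "I_chi \<Lambda> m n us ls s =
     ((\<Prod>(b, B, \<beta>)\<leftarrow>take m ls. Gamma_pow \<Lambda> b B \<beta> s) *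
      (\<Prod>(a, A, \<alpha>)\<leftarrow>take n us. Gamma_pow \<Lambda> (1 - a) (- A) \<alpha> s)) /
     ((\<Prod>(b, B, \<beta>)\<leftarrow>drop m ls. Gamma_pow \<Lambda> (1 - b) (- B) \<beta> s) *
      (\<Prod>(a, A, \<alpha>)\<leftarrow>drop n us. Gamma_pow \<Lambda> a A \<alpha> s))"

text \<open>
  \<open>I_fun \<Lambda> m n us ls z \<theta>\<close> is the \<open>I\<close>-function at \<open>z \<noteq> 0\<close> with chosen argument \<open>\<theta> = arg z\<close>;
  the contour is parametrized by \<open>s = \<i>\<tau>\<close>.
\<close>

definition I_fun ::
  "branch \<Rightarrow> nat \<Rightarrow> nat \<Rightarrow> triple list \<Rightarrow> triple list \<Rightarrow> complex \<Rightarrow> real \<Rightarrow> complex" where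
  "I_fun \<Lambda> m n us ls z \<theta> = 1 / (2 * of_real pi * \<i>) *
     (LINT \<tau>|lborel. I_chi \<Lambda> m n us ls (\<i> * of_real \<tau>) *
        exp (- (\<i> * of_real \<tau>) * (of_real (ln (cmod z)) + \<i> * of_real \<theta>)) * \<i>)"

definition I_mu :: "triple list \<Rightarrow> triple list \<Rightarrow> real" where
  "I_mu us ls = (\<Sum>(b, B, \<beta>)\<leftarrow>ls. \<beta> * B) - (\<Sum>(a, A, \<alpha>)\<leftarrow>us. \<alpha> * A)"

definition I_Omega :: "triple list \<Rightarrow> triple list \<Rightarrow> real" where
  "I_Omega us ls = (\<Sum>(a, A, \<alpha>)\<leftarrow>us. (1/2 - Re a) * \<alpha>) - (\<Sum>(b, B, \<beta>)\<leftarrow>ls. (1/2 - Re b) * \<beta>)"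

definition I_Delta :: "nat \<Rightarrow> nat \<Rightarrow> triple list \<Rightarrow> triple list \<Rightarrow> real" where
  "I_Delta m n us ls =
     (\<Sum>(b, B, \<beta>)\<leftarrow>take m ls. \<beta> * B) - (\<Sum>(b, B, \<beta>)\<leftarrow>drop m ls. \<beta> * B) +
     (\<Sum>(a, A, \<alpha>)\<leftarrow>take n us. \<alpha> * A) - (\<Sum>(a, A, \<alpha>)\<leftarrow>drop n us. \<alpha> * A)"

text \<open>Absolute convergence on the contour \<open>Re s = \<sigma>\<close>, for \<open>arg z = \<theta>\<close>.\<close>

definition I_conv :: "real \<Rightarrow> nat \<Rightarrow> nat \<Rightarrow> triple list \<Rightarrow> triple list \<Rightarrow> real \<Rightarrow> bool" where
  "I_conv \<sigma> m n us ls \<theta> \<longleftrightarrow>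
     (I_Delta m n us ls > 0 \<and> \<bar>\<theta>\<bar> < pi / 2 * I_Delta m n us ls) \<or>
     (I_Delta m n us ls \<ge> 0 \<and> \<bar>\<theta>\<bar> = pi / 2 * I_Delta m n us ls \<and>
       (I_mu us ls = 0 \<and> I_Omega us ls < -1 \<or>
        I_mu us ls \<noteq> 0 \<and> I_Omega us ls + \<sigma> * I_mu us ls < -1))"

definition I_standing :: "nat \<Rightarrow> nat \<Rightarrow> triple list \<Rightarrow> triple list \<Rightarrow> real \<Rightarrow> bool" where
  "I_standing m n us ls \<theta> \<longleftrightarrow>
     m \<le> length ls \<and> n \<le> length us \<and>
     (\<forall>(a, A, \<alpha>)\<in>set us. A > 0 \<and> \<alpha> > 0) \<and>
     (\<forall>(b, B, \<beta>)\<in>set ls. B > 0 \<and> \<beta> > 0) \<and>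
     (\<forall>(b, B, \<beta>)\<in>set (take m ls). \<forall>s. b + of_real B * s \<in> \<int>\<^sub>\<le>\<^sub>0 \<longrightarrow> Re s < 0) \<and>
     (\<forall>(a, A, \<alpha>)\<in>set (take n us). \<forall>s. 1 - a - of_real A * s \<in> \<int>\<^sub>\<le>\<^sub>0 \<longrightarrow> Re s > 0) \<and>
     I_conv 0 m n us ls \<theta>"

text \<open>The power series of \<open>\<^sub>2F\<^sub>1\<close>; below it is only needed on the real interval \<open>(0, 1)\<close>.\<close>

definition hyp2F1 :: "complex \<Rightarrow> complex \<Rightarrow> complex \<Rightarrow> complex \<Rightarrow> complex" where
  "hyp2F1 a b c z = eval_fps (fps_hypergeo [a, b] [c] 1) z"

definition saigo_integrand ::
  "complex \<Rightarrow> complex \<Rightarrow> complex \<Rightarrow> (real \<Rightarrow> complex) \<Rightarrow> real \<Rightarrow> real \<Rightarrow> complex" where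
  "saigo_integrand \<alpha> \<beta> \<gamma> f x t =
     of_real (x - t) powr (\<alpha> - 1) * hyp2F1 (\<alpha> + \<beta>) (- \<gamma>) \<alpha> (of_real (1 - t / x)) * f t"

definition saigo ::
  "complex \<Rightarrow> complex \<Rightarrow> complex \<Rightarrow> (real \<Rightarrow> complex) \<Rightarrow> real \<Rightarrow> complex" where
  "saigo \<alpha> \<beta> \<gamma> f x = of_real x powr (- \<alpha> - \<beta>) / Gamma \<alpha> *
     (LINT t:{0<..<x}|lborel. saigo_integrand \<alpha> \<beta> \<gamma> f x t)"

end

theory Submission
  imports Defs "HOL-Real_Asymp.Real_Asymp"
begin

text \<open>
  Replacing \<open>\<rho>\<close> by \<open>\<rho> - \<mu> s\<close> is the whole effect of multiplying a power function by the factor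
  \<open>(t\<^sup>\<mu>)\<^sup>-\<^sup>s\<close> under the contour integral. On power functions the operator acts by
  sending \<open>t\<^sup>\<rho>\<^sup>-\<^sup>1\<close> to \<open>\<Gamma>(\<rho>) \<Gamma>(\<rho> + \<gamma> - \<beta>) / (\<Gamma>(\<rho> - \<beta>) \<Gamma>(\<rho> + \<alpha> + \<gamma>)) x\<^sup>\<rho>\<^sup>-\<^sup>\<beta>\<^sup>-\<^sup>1\<close>.
  The four Gamma factors at \<open>\<rho> - \<mu> s\<close> are exactly those that the two new upper and the two new
  lower triples contribute to \<open>\<chi>(s)\<close>. So the formula amounts to this action on powers, together
  with an interchange of the \<open>t\<close>-integral and the contour integral.

  Action on powers (\<open>saigo_kernel_power\<close>). After \<open>t = x (1 - u)\<close> the hypergeometric series is integrated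
  term by term against \<open>u\<^sup>\<alpha>\<^sup>-\<^sup>1 (1 - u)\<^sup>\<rho>\<^sup>-\<^sup>1\<close>. Every term is a Beta integral, and the resulting series
  is \<open>\<^sub>2F\<^sub>1(\<alpha> + \<beta>, -\<gamma>; \<alpha> + \<rho>; 1)\<close>, which Gauss's theorem (\<open>gauss_hypergeometric\<close>) evaluates. The hypothesis
  \<open>Re \<rho> > Re (\<beta> - \<gamma>)\<close> is the condition for its convergence. The Beta integral with complex
  exponents is obtained the same way, from the binomial series and Gauss's theorem.

  Interchange. Since the contour is the imaginary axis, \<open>(t\<^sup>\<mu>)\<^sup>-\<^sup>s\<close> has modulus \<open>1\<close>. The double integrand
  is therefore, up to a unimodular factor, a function of \<open>t\<close> times a function of \<open>s\<close>, and Fubini's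
  theorem applies once each of them is integrable. For the function of \<open>s\<close> this needs the
  size of \<open>\<chi>\<close>, including the power of \<open>|s|\<close>, because of the boundary case \<open>|arg z| = \<pi> \<Delta> / 2\<close>. It follows
  from \<open>|\<Gamma>(\<sigma> + \<i> \<tau>)| \<asymp> |\<tau>|\<^sup>\<sigma>\<^sup>-\<^sup>1\<^sup>/\<^sup>2 exp (-\<pi> |\<tau>| / 2)\<close> (\<open>norm_rGamma_vertical\<close>), which gives
  \<open>|\<chi>(\<i> \<tau>)| \<asymp> |\<tau>|\<^sup>\<Omega> exp (-\<pi> \<Delta> |\<tau>| / 2)\<close> (\<open>I_chi_abs_bigtheta\<close>), so that the convergence conditions yield absolute
  integrability.
\<close>

section \<open>Growth of Pochhammer symbols\<close>

lemma notin_nonpos_Ints_if_Re_pos: "Re z > 0 \<Longrightarrow> z \<notin> \<int>\<^sub>\<le>\<^sub>0"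
  by (auto elim!: nonpos_Ints_cases)

text \<open>
  The Euler sequence \<open>rGamma_series\<close> converges to \<open>1 / \<Gamma>(z)\<close>, and the modulus of its \<open>n\<close>-th term is
  the quotient below up to the factor \<open>|z + n| / n\<close>.
\<close>
lemma pochhammer_asymp:
  fixes z :: complex
  shows "(\<lambda>n. norm (pochhammer z n) / (fact n * real n powr (Re z - 1))) \<longlonglongrightarrow> norm (rGamma z)"
proof -
  have "(\<lambda>n. norm (rGamma_series z n) * norm (of_nat n / (z + of_nat n))) \<longlonglongrightarrow> norm (rGamma z) * norm (1 :: complex)"
  proof (intro tendsto_mult tendsto_norm rGamma_series_LIMSEQ)
    have "(\<lambda>n. 1 / (z * (1 / of_nat n) + 1)) \<longlonglongrightarrow> 1 / (z * 0 + 1 :: complex)"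
      by (intro tendsto_intros lim_1_over_n) auto
    moreover have "\<forall>\<^sub>F n in sequentially. 1 / (z * (1 / of_nat n) + 1) = of_nat n / (z + of_nat n)"
      using eventually_gt_at_top[of 0] by eventually_elim (auto simp: field_simps)
    ultimately show "(\<lambda>n. of_nat n / (z + of_nat n)) \<longlonglongrightarrow> 1"
      by (simp add: tendsto_cong)
  qed
  moreover have "\<forall>\<^sub>F n in sequentially. norm (rGamma_series z n) * norm (of_nat n / (z + of_nat n)) =
      norm (pochhammer z n) / (fact n * real n powr (Re z - 1))"
    using eventually_gt_at_top[of "nat \<lceil>norm z\<rceil>"]
  proof eventually_elim
    case (elim n)
    have n: "real n > norm z" "n > 0" using elim by linarith+
    have "z + of_nat n \<noteq> 0"
    proof
      assume "z + of_nat n = 0"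
      hence "z = - of_nat n" by (simp add: eq_neg_iff_add_eq_0)
      hence "norm z = real n" by simp
      thus False using n by simp
    qed
    moreover have "norm (exp (z * of_real (ln (real n)))) = real n powr Re z"
      using n by (simp add: powr_def mult.commute)
    ultimately show ?case using n
      by (simp add: rGamma_series_def pochhammer_Suc norm_mult norm_divide powr_diff divide_simps)
  qed
  ultimately show ?thesis by (simp add: tendsto_cong)
qed

lemma pochhammer_bigo:
  fixes z :: complex
  shows "(\<lambda>n. norm (pochhammer z n)) \<in> O(\<lambda>n. fact n * real n powr (Re z - 1))"
  by (rule bigoI_tendsto[OF pochhammer_asymp])
     (auto intro!: eventually_mono[OF eventually_gt_at_top[of 0]])

lemma pochhammer_bigtheta:
  fixes z :: complex
  assumes "z \<notin> \<int>\<^sub>\<le>\<^sub>0"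
  shows "(\<lambda>n. norm (pochhammer z n)) \<in> \<Theta>(\<lambda>n. fact n * real n powr (Re z - 1))"
  by (rule bigthetaI_tendsto[OF _ pochhammer_asymp]) (use assms in \<open>auto simp: rGamma_eq_zero_iff\<close>)

section \<open>Gauss's theorem\<close>

definition hyp_coeff :: "complex \<Rightarrow> complex \<Rightarrow> complex \<Rightarrow> nat \<Rightarrow> complex" where
  "hyp_coeff a b c n = pochhammer a n * pochhammer b n / (pochhammer c n * fact n)"

lemma fps_hypergeo_coeff: "fps_nth (fps_hypergeo [a, b] [c] 1) n = hyp_coeff a b c n"
  by (simp add: hyp_coeff_def)

lemma hyp_coeff_bigo:
  assumes "c \<notin> \<int>\<^sub>\<le>\<^sub>0"
  shows "(\<lambda>n. norm (hyp_coeff a b c n)) \<in> O(\<lambda>n. real n powr (Re (a + b - c) - 1))"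
proof -
  have "(\<lambda>n. norm (pochhammer a n) * norm (pochhammer b n) / (norm (pochhammer c n) * fact n)) \<in>
     O(\<lambda>n. (fact n * real n powr (Re a - 1)) * (fact n * real n powr (Re b - 1)) / 
            ((fact n * real n powr (Re c - 1)) * fact n))"
  proof (rule landau_o.big.divide)
    have pnz: "pochhammer c n \<noteq> 0" for n
      using assms pochhammer_eq_0_imp_nonpos_Int by blast
    show "\<forall>\<^sub>F n in sequentially. norm (pochhammer c n) * fact n \<noteq> 0" by (simp add: pnz)
    show "\<forall>\<^sub>F n in sequentially. fact n * real n powr (Re c - 1) * fact n \<noteq> 0"
      by (auto intro: eventually_mono[OF eventually_gt_at_top[of 0]])
    have "(\<lambda>n. fact n * real n powr (Re c - 1)) \<in> O(\<lambda>n. norm (pochhammer c n))"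
      using pochhammer_bigtheta[OF assms] by (simp add: bigtheta_sym bigthetaD1)
    thus "(\<lambda>n. fact n * real n powr (Re c - 1) * fact n) \<in> O(\<lambda>n. norm (pochhammer c n) * fact n)"
      by (rule landau_o.big.mult[OF _ landau_o.big_refl])
  qed (intro landau_o.big.mult pochhammer_bigo)
  also have "(\<lambda>n. norm (pochhammer a n) * norm (pochhammer b n) / (norm (pochhammer c n) * fact n)) =
    (\<lambda>n. norm (hyp_coeff a b c n))"
    by (simp add: hyp_coeff_def norm_mult norm_divide)
  also have "(\<lambda>n. (fact n * real n powr (Re a - 1)) * (fact n * real n powr (Re b - 1)) / 
            ((fact n * real n powr (Re c - 1)) * fact n)) = (\<lambda>n. real n powr (Re (a + b - c) - 1))"
  proof
    fix n :: nat
    show "(fact n * real n powr (Re a - 1)) * (fact n * real n powr (Re b - 1)) /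
        ((fact n * real n powr (Re c - 1)) * fact n) = real n powr (Re (a + b - c) - 1)"
    proof -
      have "(fact n * x) * (fact n * y) / ((fact n * z) * fact n) = x * y / z" for x y z :: real
        by simp
      hence "(fact n * real n powr (Re a - 1)) * (fact n * real n powr (Re b - 1)) /
        ((fact n * real n powr (Re c - 1)) * fact n) =
        real n powr (Re a - 1) * real n powr (Re b - 1) / real n powr (Re c - 1)" .
      also have "\<dots> = real n powr ((Re a - 1) + (Re b - 1) - (Re c - 1))"
        by (simp only: powr_add powr_diff)
      finally show ?thesis by (simp add: algebra_simps)
    qed
  qed
  finally show ?thesis .
qed

lemma summable_bigo_powr:
  fixes f :: "nat \<Rightarrow> real"
  assumes "f \<in> O(\<lambda>n. real n powr e)" "e < -1"
  shows "summable f"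
proof (rule summable_comparison_test_bigo[OF _ assms(1)])
  show "summable (\<lambda>n. norm (real n powr e))" using assms(2) by (simp add: summable_real_powr_iff)
qed

lemma summable_hyp_coeff:
  assumes "c \<notin> \<int>\<^sub>\<le>\<^sub>0" "Re (c - a - b) > 0"
  shows "summable (\<lambda>n. norm (hyp_coeff a b c n))"
  by (rule summable_bigo_powr[OF hyp_coeff_bigo[OF assms(1), of a b]]) (use assms in auto)

lemma nonpos_Ints_plus_nat:
  fixes c :: complex
  assumes "c \<notin> \<int>\<^sub>\<le>\<^sub>0" shows "c + of_nat n \<notin> \<int>\<^sub>\<le>\<^sub>0"
  using assms nonpos_Ints_diff_Nats[of "c + of_nat n" "of_nat n"] by auto

lemma bigo_tendsto_zero:
  fixes f g :: "nat \<Rightarrow> real"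
  assumes "f \<in> O(g)" "g \<longlonglongrightarrow> 0"
  shows "f \<longlonglongrightarrow> 0"
proof -
  have "g \<in> o(\<lambda>_. 1)" using assms(2) by (intro smalloI_tendsto) auto
  with assms(1) have "f \<in> o(\<lambda>_. 1)" by (rule landau_o.big_small_trans)
  thus ?thesis by (auto dest: smalloD_tendsto)
qed

text \<open>
  With \<open>h k\<close> the \<open>k\<close>-th coefficient for \<open>c\<close>, the difference of the two sides is, term by term, the
  increment of \<open>G k = - c k h k\<close>. It telescopes, and \<open>G\<close> tends to \<open>0\<close> because
  \<open>h k = O(k\<^sup>e)\<close> with \<open>e = Re (a + b - c) - 1 < -1\<close>.
\<close>
lemma hyp_sum_contiguous:
  assumes c: "c \<notin> \<int>\<^sub>\<le>\<^sub>0" and re: "Re (c - a - b) > 0"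
  shows "c * (c - a - b) * (\<Sum>n. hyp_coeff a b c n) = (c - a) * (c - b) * (\<Sum>n. hyp_coeff a b (c + 1) n)"
proof -
  define G where "G = (\<lambda>k. - c * of_nat k * hyp_coeff a b c k)"
  have c1: "c + 1 \<notin> \<int>\<^sub>\<le>\<^sub>0" using nonpos_Ints_plus_nat[OF c, of 1] by simp
  have s1: "summable (hyp_coeff a b c)"
    by (rule summable_norm_cancel[OF summable_hyp_coeff[OF c re]])
  have s2: "summable (hyp_coeff a b (c+1))"
    by (rule summable_norm_cancel[OF summable_hyp_coeff[OF c1]]) (use re in auto)
  have nz: "c + of_nat k \<noteq> 0" for k
    using nonpos_Ints_plus_nat[OF c, of k] by auto
  have pnz: "pochhammer c k \<noteq> 0" for k
    using c pochhammer_eq_0_imp_nonpos_Int by blast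
  have rel: "hyp_coeff a b (c + 1) k = c / (c + of_nat k) * hyp_coeff a b c k" for k
  proof -
    have "pochhammer c k * (c + of_nat k) = c * pochhammer (c + 1) k"
      using pochhammer_rec[of c k] pochhammer_rec'[of c k] by (simp add: mult.commute)
    moreover have "pochhammer (c + 1) k \<noteq> 0" using c1 pochhammer_eq_0_imp_nonpos_Int by blast
    ultimately show ?thesis using nz[of k] pnz[of k] nz[of 0]
      by (simp add: hyp_coeff_def divide_simps mult_ac)
  qed
  have suc: "hyp_coeff a b c (Suc k) = (a + of_nat k) * (b + of_nat k) / ((c + of_nat k) * of_nat (Suc k)) * hyp_coeff a b c k" for k
    by (simp add: hyp_coeff_def pochhammer_Suc mult_ac)
  have tele: "G (Suc k) - G k = c * (c - a - b) * hyp_coeff a b c k - (c - a) * (c - b) * hyp_coeff a b (c + 1) k" for k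
  proof -
    have k1: "of_nat (Suc k) \<noteq> (0::complex)" by (rule of_nat_neq_0)
    \<comment> \<open>Both coefficients are polynomial multiples of this quotient, so the identity becomes polynomial.\<close>
    define Y where "Y = hyp_coeff a b c k / (c + of_nat k)"
    have X: "hyp_coeff a b c k = (c + of_nat k) * Y" using nz[of k] by (simp add: Y_def)
    have "of_nat (Suc k) * hyp_coeff a b c (Suc k) = (a + of_nat k) * (b + of_nat k) * Y"
      using nz[of k] k1 by (simp add: suc Y_def)
    hence "G (Suc k) = - c * ((a + of_nat k) * (b + of_nat k) * Y)"
      by (simp only: G_def mult.assoc)
    moreover have "hyp_coeff a b (c + 1) k = c * Y" by (simp add: rel Y_def)
    ultimately show ?thesis unfolding X G_def by (simp only:) (simp add: algebra_simps)
  qed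
  have "G \<longlonglongrightarrow> 0"
  proof -
    have "(\<lambda>k. norm (G k)) \<in> O(\<lambda>k. real k * real k powr (Re (a + b - c) - 1))"
    proof -
      have "(\<lambda>k. norm c * (real k * norm (hyp_coeff a b c k))) \<in> O(\<lambda>k. real k * real k powr (Re (a + b - c) - 1))"
        using landau_o.big.mult[OF landau_o.big_refl hyp_coeff_bigo[OF c, of a b], of real]
        by (cases "c = 0") simp_all
      thus ?thesis by (simp add: G_def norm_mult mult_ac)
    qed
    also have "(\<lambda>k. real k * real k powr (Re (a + b - c) - 1)) = (\<lambda>k. real k powr Re (a + b - c))"
      by (auto simp: fun_eq_iff powr_diff)
    finally have "(\<lambda>k. norm (G k)) \<in> O(\<lambda>k. real k powr Re (a + b - c))" .
    moreover have "(\<lambda>k. real k powr Re (a + b - c)) \<longlonglongrightarrow> 0"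
      by (rule tendsto_neg_powr[OF _ filterlim_real_sequentially]) (use re in simp)
    ultimately have "(\<lambda>k. norm (G k)) \<longlonglongrightarrow> 0"
      by (rule bigo_tendsto_zero)
    thus ?thesis by (simp add: tendsto_norm_zero_iff)
  qed
  from telescope_sums[OF this] have "(\<lambda>k. G (Suc k) - G k) sums 0" by (simp add: G_def)
  moreover have "(\<lambda>k. G (Suc k) - G k) sums (c * (c - a - b) * (\<Sum>n. hyp_coeff a b c n) - (c - a) * (c - b) * (\<Sum>n. hyp_coeff a b (c + 1) n))"
    unfolding tele by (intro sums_diff sums_mult summable_sums s1 s2)
  ultimately show ?thesis using sums_unique2 by fastforce
qed

lemma hyp_sum_iterate:
  assumes c: "c \<notin> \<int>\<^sub>\<le>\<^sub>0" and re: "Re (c - a - b) > 0"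
  shows "pochhammer c N * pochhammer (c - a - b) N * (\<Sum>n. hyp_coeff a b c n) = 
         pochhammer (c - a) N * pochhammer (c - b) N * (\<Sum>n. hyp_coeff a b (c + of_nat N) n)"
proof (induction N)
  case (Suc N)
  have "(c + of_nat N) * (c + of_nat N - a - b) * (\<Sum>n. hyp_coeff a b (c + of_nat N) n) =
        (c + of_nat N - a) * (c + of_nat N - b) * (\<Sum>n. hyp_coeff a b (c + of_nat N + 1) n)"
    by (rule hyp_sum_contiguous) (use nonpos_Ints_plus_nat[OF c, of N] re in auto)
  hence *: "(c + of_nat N) * (c - a - b + of_nat N) * (\<Sum>n. hyp_coeff a b (c + of_nat N) n) =
        (c - a + of_nat N) * (c - b + of_nat N) * (\<Sum>n. hyp_coeff a b (c + of_nat (Suc N)) n)"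
    by (simp add: algebra_simps)
  have "pochhammer c (Suc N) * pochhammer (c - a - b) (Suc N) * (\<Sum>n. hyp_coeff a b c n) =
    (c + of_nat N) * (c - a - b + of_nat N) * (pochhammer c N * pochhammer (c - a - b) N * (\<Sum>n. hyp_coeff a b c n))"
    by (simp add: pochhammer_Suc mult_ac)
  also have "\<dots> = pochhammer (c - a) N * pochhammer (c - b) N * ((c + of_nat N) * (c - a - b + of_nat N) * (\<Sum>n. hyp_coeff a b (c + of_nat N) n))"
    unfolding Suc.IH by (simp add: mult_ac)
  also have "\<dots> = pochhammer (c - a) (Suc N) * pochhammer (c - b) (Suc N) * (\<Sum>n. hyp_coeff a b (c + of_nat (Suc N)) n)"
    unfolding * by (simp add: pochhammer_Suc mult_ac)
  finally show ?case .
qed auto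

text \<open>
  All coefficients but the zeroth tend to \<open>0\<close> when the lower parameter moves to the right, and for
  large shifts they are dominated by those of one fixed convergent series, because the modulus of \<open>c + N + i\<close>
  grows with \<open>N\<close> as soon as its real part is positive.
\<close>
lemma hyp_sum_shift_limit:
  "(\<lambda>N. \<Sum>n. hyp_coeff a b (c + of_nat N) n) \<longlonglongrightarrow> 1"
proof -
  \<comment> \<open>Large enough that both \<open>c + M\<close> and \<open>c + M - a - b\<close> have positive real part.\<close>
  define M where "M = nat \<lceil>norm c + norm a + norm b\<rceil> + 1"
  have M: "real M > norm c + norm a + norm b" unfolding M_def by linarith
  define d where "d = c + of_nat M"
  have Red: "Re d > 0" "Re (d - a - b) > 0"
  proof -
    have "Re a \<le> norm a" "Re b \<le> norm b" "- Re c \<le> norm c"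
      using complex_Re_le_cmod[of a] complex_Re_le_cmod[of b] complex_Re_le_cmod[of "- c"] by simp_all
    moreover have "0 \<le> norm a" "0 \<le> norm b" by (rule norm_ge_zero)+
    moreover have "Re d = Re c + real M" "Re (d - a - b) = Re c + real M - Re a - Re b" by (simp_all add: d_def)
    ultimately show "Re d > 0" "Re (d - a - b) > 0" using M by linarith+
  qed
  have d: "d \<notin> \<int>\<^sub>\<le>\<^sub>0" using Red notin_nonpos_Ints_if_Re_pos by blast
  have dom: "norm (hyp_coeff a b (c + of_nat N) k) \<le> norm (hyp_coeff a b d k)" if "N \<ge> M" for N k
  proof -
    have "norm (pochhammer d k) \<le> norm (pochhammer (c + of_nat N) k)"
      unfolding pochhammer_prod prod_norm[symmetric]
    proof (intro prod_mono conjI)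
      fix i assume "i \<in> {0..<k}"
      have "norm (d + of_nat i) ^ 2 \<le> norm (c + of_nat N + of_nat i) ^ 2"
        unfolding cmod_power2
      proof (rule add_mono)
        show "Re (d + of_nat i) ^ 2 \<le> Re (c + of_nat N + of_nat i) ^ 2"
          by (rule power_mono) (use Red that in \<open>auto simp: d_def\<close>)
      qed (auto simp: d_def)
      thus "norm (d + of_nat i) \<le> norm (c + of_nat N + of_nat i)"
        by (rule power2_le_imp_le) simp
    qed auto
    moreover have "pochhammer d k \<noteq> 0" using d pochhammer_eq_0_imp_nonpos_Int by blast
    ultimately have "norm (pochhammer d k) * norm (fact k :: complex) > 0"
      "norm (pochhammer d k) * norm (fact k :: complex) \<le> norm (pochhammer (c + of_nat N) k) * norm (fact k :: complex)"
      by (simp, intro mult_right_mono, simp_all)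
    thus ?thesis unfolding hyp_coeff_def norm_mult norm_divide
      by (intro frac_le mult_nonneg_nonneg norm_ge_zero order_refl)
  qed
  have lim: "(\<lambda>N. hyp_coeff a b (c + of_nat N) k) \<longlonglongrightarrow> (if k = 0 then 1 else 0)" for k
  proof (cases k)
    case (Suc j)
    have "filterlim (\<lambda>N. pochhammer (c + of_nat N) (Suc j)) at_infinity sequentially"
    proof (induction j)
      case 0
      have "filterlim (\<lambda>N. c + of_nat N) at_infinity sequentially"
        by (intro tendsto_add_filterlim_at_infinity[OF tendsto_const] tendsto_of_nat)
      thus ?case by simp
    next
      case (Suc j)
      have "filterlim (\<lambda>N. (c + of_nat (Suc j)) + of_nat N) at_infinity sequentially"
        by (intro tendsto_add_filterlim_at_infinity[OF tendsto_const] tendsto_of_nat)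
      moreover have "pochhammer (c + of_nat N) (Suc (Suc j)) =
          pochhammer (c + of_nat N) (Suc j) * ((c + of_nat (Suc j)) + of_nat N)" for N
        by (subst pochhammer_Suc) (simp only: add_ac)
      ultimately show ?case
        using filterlim_at_infinity_times[OF Suc] by (simp only:)
    qed
    from tendsto_divide_0[OF tendsto_const this, of "pochhammer a k * pochhammer b k / fact k"] 
    show ?thesis unfolding Suc hyp_coeff_def by (simp add: mult_ac del: fact_Suc)
  qed (auto simp: hyp_coeff_def)
  have "(\<lambda>N. \<Sum>k. hyp_coeff a b (c + of_nat N) k) \<longlonglongrightarrow> (\<Sum>k. if k = 0 then 1 else 0)"
  proof (rule tannerys_theorem[THEN conjunct2, THEN conjunct2])
    show "\<forall>\<^sub>F (k, N) in sequentially \<times>\<^sub>F sequentially. norm (hyp_coeff a b (c + of_nat N) k) \<le> norm (hyp_coeff a b d k)"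
      unfolding eventually_prod_sequentially using dom by (intro exI[of _ M]) auto
    show "summable (\<lambda>k. norm (hyp_coeff a b d k))" by (rule summable_hyp_coeff[OF d Red(2)])
  qed (use lim in auto)
  also have "(\<Sum>k::nat. if k = 0 then 1 else 0 :: complex) = 1"
    by (subst suminf_finite[of "{0}"]) auto
  finally show ?thesis .
qed

text \<open>
  Iterating the contiguous relation expresses the sum by a quotient of Pochhammer symbols. This
  quotient is a quotient of Euler sequences for the four reciprocal Gamma functions: the powers of
  \<open>N\<close> cancel since \<open>c + (c - a - b) = (c - a) + (c - b)\<close>. Reciprocal Gamma functions
  cover the case in which \<open>c - a\<close> or \<open>c - b\<close> is a pole of \<open>\<Gamma>\<close> and the sum vanishes.
\<close>
theorem gauss_hypergeometric:
  assumes c: "c \<notin> \<int>\<^sub>\<le>\<^sub>0" and re: "Re (c - a - b) > 0"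
  shows "hyp_coeff a b c sums (Gamma c * Gamma (c - a - b) * rGamma (c - a) * rGamma (c - b))"
proof -
  let ?S = "\<Sum>n. hyp_coeff a b c n"
  have re': "c - a - b \<notin> \<int>\<^sub>\<le>\<^sub>0" using re notin_nonpos_Ints_if_Re_pos by blast
  have eq: "rGamma_series c N * rGamma_series (c - a - b) N * ?S = 
    rGamma_series (c - a) N * rGamma_series (c - b) N * (\<Sum>n. hyp_coeff a b (c + of_nat (Suc N)) n)" for N
  proof -
    have "exp (c * of_real (ln N)) * exp ((c - a - b) * of_real (ln N)) = 
          exp ((c - a) * of_real (ln N)) * exp ((c - b) * of_real (ln N))"
      unfolding exp_add[symmetric] by (simp add: algebra_simps)
    thus ?thesis using hyp_sum_iterate[OF assms, of "Suc N"]
      by (simp add: rGamma_series_def divide_simps)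
  qed
  have "(\<lambda>N. rGamma_series c N * rGamma_series (c - a - b) N * ?S) \<longlonglongrightarrow> rGamma c * rGamma (c - a - b) * ?S"
    by (intro tendsto_intros)
  moreover have "(\<lambda>N. rGamma_series c N * rGamma_series (c - a - b) N * ?S) \<longlonglongrightarrow> rGamma (c - a) * rGamma (c - b) * 1"
    unfolding eq by (intro tendsto_intros LIMSEQ_Suc[OF hyp_sum_shift_limit])
  ultimately have "rGamma c * rGamma (c - a - b) * ?S = rGamma (c - a) * rGamma (c - b) * 1"
    by (rule LIMSEQ_unique)
  hence "?S = Gamma c * Gamma (c - a - b) * rGamma (c - a) * rGamma (c - b)"
    using c re' by (simp add: Gamma_def field_simps rGamma_eq_zero_iff)
  moreover have "summable (hyp_coeff a b c)"
    by (rule summable_norm_cancel[OF summable_hyp_coeff[OF assms]])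
  ultimately show ?thesis by (simp add: sums_iff)
qed

section \<open>Beta integrals with complex exponents\<close>

lemma Beta_plus_nat:
  fixes a b :: "'a :: Gamma"
  assumes "a \<notin> \<int>\<^sub>\<le>\<^sub>0" "a + b \<notin> \<int>\<^sub>\<le>\<^sub>0"
  shows "Beta (a + of_nat n) b = Beta a b * pochhammer a n / pochhammer (a + b) n"
proof -
  have "Gamma a \<noteq> 0" "Gamma (a + b) \<noteq> 0" using assms by (simp_all add: Gamma_eq_zero_iff)
  moreover have "Gamma (a + of_nat n) = pochhammer a n * Gamma a"
    using pochhammer_Gamma[OF assms(1), of n] calculation by simp
  moreover have "Gamma (a + of_nat n + b) = pochhammer (a + b) n * Gamma (a + b)"
    using pochhammer_Gamma[OF assms(2), of n] calculation by (simp add: add_ac)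
  ultimately show ?thesis by (simp add: Beta_def mult_ac)
qed

text \<open>
  This decay makes up for the growth of the coefficients of the power series that are
  integrated term by term below.
\<close>
lemma Beta_plus_nat_bigo:
  fixes x y :: real
  assumes "x > 0" "y > 0"
  shows "(\<lambda>n. Beta (x + real n) y) \<in> O(\<lambda>n. real n powr (- y))"
proof -
  have nn: "x \<notin> \<int>\<^sub>\<le>\<^sub>0" "x + y \<notin> \<int>\<^sub>\<le>\<^sub>0"
    using assms by (auto elim!: nonpos_Ints_cases)
  have cn: "complex_of_real x + complex_of_real y \<notin> \<int>\<^sub>\<le>\<^sub>0"
    using assms by (intro notin_nonpos_Ints_if_Re_pos) auto
  have pos: "pochhammer z n > 0" if "z > 0" for z :: real and n
    using that by (simp add: pochhammer_prod prod_pos)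
  have norm: "norm (pochhammer (complex_of_real z) n) = pochhammer z n" if "z > 0" for z n
    using pos[OF that, of n] by (simp add: pochhammer_of_real)
  have xb: "(\<lambda>n. pochhammer x n) \<in> O(\<lambda>n. fact n * real n powr (x - 1))"
    using pochhammer_bigo[of "complex_of_real x"] norm[OF assms(1)] by simp
  have xyb: "(\<lambda>n. fact n * real n powr (x + y - 1)) \<in> O(\<lambda>n. pochhammer (x + y) n)"
  proof -
    have "(\<lambda>n. norm (pochhammer (complex_of_real (x + y)) n)) \<in> \<Theta>(\<lambda>n. fact n * real n powr (x + y - 1))"
      using pochhammer_bigtheta[OF cn] by simp
    hence "(\<lambda>n. pochhammer (x + y) n) \<in> \<Theta>(\<lambda>n. fact n * real n powr (x + y - 1))"
      using norm[of "x + y"] assms by (simp only: add_pos_pos)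
    thus ?thesis by (metis bigtheta_sym bigthetaD1)
  qed
  have "(\<lambda>n. pochhammer x n / pochhammer (x + y) n) \<in>
      O(\<lambda>n. (fact n * real n powr (x - 1)) / (fact n * real n powr (x + y - 1)))"
  proof (rule landau_o.big.divide[OF _ _ xb xyb])
    show "\<forall>\<^sub>F n in sequentially. pochhammer (x + y) n \<noteq> 0"
      using pos[of "x + y"] assms by (intro always_eventually allI) (metis add_pos_pos less_irrefl)
    show "\<forall>\<^sub>F n in sequentially. fact n * real n powr (x + y - 1) \<noteq> 0"
      by (rule eventually_mono[OF eventually_gt_at_top[of 0]]) auto
  qed
  also have "(\<lambda>n. (fact n * real n powr (x - 1)) / (fact n * real n powr (x + y - 1))) = (\<lambda>n. real n powr (- y))"
  proof
    fix n :: nat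
    have "(fact n * real n powr (x - 1)) / (fact n * real n powr (x + y - 1)) = real n powr (x - 1) / real n powr (x + y - 1)"
      by simp
    also have "\<dots> = real n powr ((x - 1) - (x + y - 1))" by (simp only: powr_diff)
    finally show "(fact n * real n powr (x - 1)) / (fact n * real n powr (x + y - 1)) = real n powr (- y)" by simp
  qed
  finally have "(\<lambda>n. Beta x y * (pochhammer x n / pochhammer (x + y) n)) \<in> O(\<lambda>n. 1 * real n powr (- y))"
    by (intro landau_o.big.mult) simp_all
  thus ?thesis by (simp add: Beta_plus_nat[OF nn])
qed

lemma set_integrable_lborel_if_has_integral_nonneg:
  fixes f :: "real \<Rightarrow> real"
  assumes I: "(f has_integral I) A" and nonneg: "\<And>x. x \<in> A \<Longrightarrow> f x \<ge> 0"
    and meas: "(\<lambda>x. indicator A x *\<^sub>R f x) \<in> borel_measurable borel"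
  shows "set_integrable lborel A f" "(LINT x:A|lborel. f x) = I"
proof -
  have "f absolutely_integrable_on A"
    using I nonneg by (intro nonnegative_absolutely_integrable_1) (auto simp: integrable_on_def)
  moreover have "(LINT x:A|lebesgue. f x) = I"
    using set_lebesgue_integral_eq_integral(2)[OF calculation] I by (simp add: integral_unique)
  ultimately show "set_integrable lborel A f" "(LINT x:A|lborel. f x) = I"
    using meas by (simp_all add: set_integrable_def set_lebesgue_integral_def integrable_completion integral_completion)
qed

text \<open>
  The exponents are normalized so that the integral over the unit interval is \<open>B(a, b)\<close>, and so that
  multiplication by \<open>u\<^sup>k\<close> replaces \<open>a\<close> by \<open>a + k\<close>.
\<close>
definition beta_density :: "complex \<Rightarrow> complex \<Rightarrow> real \<Rightarrow> complex" where
  "beta_density a b u = of_real u powr (a - 1) * of_real (1 - u) powr (b - 1)"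

text \<open>
  For \<open>u < 0\<close> the principal logarithm is \<open>ln (- u) + \<pi> \<i>\<close>, so the power is measurable on each half-line
  although it is discontinuous as a function on the plane.
\<close>
lemma measurable_of_real_powr [measurable]:
  "(\<lambda>u. complex_of_real u powr z) \<in> borel_measurable borel"
proof -
  have "(\<lambda>u. complex_of_real u powr z) = (\<lambda>u. if u > 0 then exp (z * of_real (ln u)) else
      if u = 0 then 0 else exp (z * (of_real (ln (- u)) + of_real pi * \<i>)))"
  proof
    fix u :: real
    show "complex_of_real u powr z = (if u > 0 then exp (z * of_real (ln u)) else
        if u = 0 then 0 else exp (z * (of_real (ln (- u)) + of_real pi * \<i>)))"
      using Ln_minus[of "complex_of_real (- u)"] Ln_of_real[of "- u"]
      by (auto simp: powr_def Ln_of_real mult.commute split: if_splits)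
  qed
  also have "\<dots> \<in> borel_measurable borel" by measurable
  finally show ?thesis .
qed

lemma beta_density_measurable [measurable]: "beta_density a b \<in> borel_measurable borel"
proof -
  have "(\<lambda>u. complex_of_real (1 - u) powr (b - 1)) \<in> borel_measurable borel"
    by (rule measurable_compose[OF _ measurable_of_real_powr]) measurable
  thus ?thesis unfolding beta_density_def by measurable
qed

lemma norm_beta_density:
  "u \<in> {0<..<1} \<Longrightarrow> norm (beta_density a b u) = u powr (Re a - 1) * (1 - u) powr (Re b - 1)"
  unfolding beta_density_def norm_mult by (subst (1 2) norm_powr_real_powr) auto

lemma beta_density_abs:
  assumes "Re a > 0" "Re b > 0"
  shows "set_integrable lborel {0<..<1} (beta_density a b)"
    and "(LINT u:{0<..<1}|lborel. norm (beta_density a b u)) = Beta (Re a) (Re b)"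
proof -
  let ?g = "\<lambda>u. u powr (Re a - 1) * (1 - u) powr (Re b - 1)"
  have "(?g has_integral Beta (Re a) (Re b)) {0<..<1}"
    using has_integral_Beta_real[OF assms] by (simp add: has_integral_Icc_iff_Ioo)
  note g = set_integrable_lborel_if_has_integral_nonneg[OF this]
  have gi: "set_integrable lborel {0<..<1} ?g" by (rule g) (auto intro!: mult_nonneg_nonneg)
  have gI: "(LINT u:{0<..<1}|lborel. ?g u) = Beta (Re a) (Re b)"
    by (rule g) (auto intro!: mult_nonneg_nonneg)
  show "set_integrable lborel {0<..<1} (beta_density a b)"
    unfolding set_integrable_def
    by (rule Bochner_Integration.integrable_bound[OF gi[unfolded set_integrable_def]])
       (auto simp: indicator_def norm_beta_density)
  show "(LINT u:{0<..<1}|lborel. norm (beta_density a b u)) = Beta (Re a) (Re b)"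
    unfolding gI[symmetric] by (rule set_lebesgue_integral_cong) (auto simp: norm_beta_density)
qed

text \<open>
  The integral of the modulus of the \<open>k\<close>-th term is \<open>|c\<^sub>k| B(Re a + k, Re b) = O(k\<^sup>e k\<^sup>-\<^sup>r)\<close> with \<open>r = Re b\<close>. This is
  summable if \<open>e < r - 1\<close>, and then sum and integral may be interchanged.
\<close>
lemma beta_density_power_series:
  fixes c :: "nat \<Rightarrow> complex"
  assumes a: "Re a > 0" and b: "Re b > 0"
    and sums: "\<And>u. u \<in> {0<..<1} \<Longrightarrow> (\<lambda>k. c k * of_real u ^ k) sums g u"
    and abs: "\<And>u. u \<in> {0<..<1} \<Longrightarrow> summable (\<lambda>k. norm (c k) * u ^ k)"
    and growth: "(\<lambda>k. norm (c k)) \<in> O(\<lambda>k. real k powr e)" and e: "e < Re b - 1"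
  shows "set_integrable lborel {0<..<1} (\<lambda>u. beta_density a b u * g u)"
    and "(\<lambda>k. c k * (LINT u:{0<..<1}|lborel. beta_density (a + of_nat k) b u)) sums
           (LINT u:{0<..<1}|lborel. beta_density a b u * g u)"
proof -
  define F where "F = (\<lambda>k u. c k * (indicator {0<..<1} u *\<^sub>R beta_density (a + of_nat k) b u))"
  have pw: "F k u = indicator {0<..<1} u *\<^sub>R (beta_density a b u * (c k * of_real u ^ k))" for k u
  proof (cases "u \<in> {0<..<1}")
    case True
    hence "complex_of_real u powr (a + of_nat k - 1) = of_real u powr (a - 1) * of_real u ^ k"
      using powr_add[of "complex_of_real u" "a - 1" "of_nat k"] by (simp add: algebra_simps powr_nat)
    thus ?thesis using True by (simp add: F_def beta_density_def mult_ac)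
  qed (auto simp: F_def)
  have int: "integrable lborel (F k)" for k
    unfolding F_def using beta_density_abs(1)[of "a + of_nat k" b] a b
    by (intro integrable_mult_right) (auto simp: set_integrable_def)
  have nint: "(LINT u|lborel. norm (F k u)) = norm (c k) * Beta (Re a + real k) (Re b)" for k
  proof -
    have "(LINT u|lborel. norm (F k u)) = 
      (LINT u|lborel. norm (c k) * (indicator {0<..<1} u *\<^sub>R norm (beta_density (a + of_nat k) b u)))"
      by (rule Bochner_Integration.integral_cong) (auto simp: F_def norm_mult)
    also have "\<dots> = norm (c k) * (LINT u:{0<..<1}|lborel. norm (beta_density (a + of_nat k) b u))"
      unfolding set_lebesgue_integral_def by (rule integral_mult_right_zero)
    also have "(LINT u:{0<..<1}|lborel. norm (beta_density (a + of_nat k) b u)) = Beta (Re a + real k) (Re b)"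
      using beta_density_abs(2)[of "a + of_nat k" b] a b by simp
    finally show ?thesis .
  qed
  have "(\<lambda>k. norm (c k) * Beta (Re a + real k) (Re b)) \<in> O(\<lambda>k. real k powr e * real k powr (- Re b))"
    by (rule landau_o.big.mult[OF growth Beta_plus_nat_bigo[OF a b]])
  also have "(\<lambda>k. real k powr e * real k powr (- Re b)) = (\<lambda>k. real k powr (e + (- Re b)))"
    by (simp only: powr_add)
  finally have summ: "summable (\<lambda>k. LINT u|lborel. norm (F k u))"
    unfolding nint by (rule summable_bigo_powr) (use e in simp)
  have "summable (\<lambda>k. norm (F k u))" for u
  proof (cases "u \<in> {0<..<1}")
    case True
    hence "(\<lambda>k. norm (F k u)) = (\<lambda>k. norm (beta_density a b u) * (norm (c k) * u ^ k))"
      by (auto simp: pw norm_mult norm_power)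
    thus ?thesis by (simp only: summable_mult[OF abs[OF True]])
  qed (auto simp: F_def)
  hence AE: "AE u in lborel. summable (\<lambda>k. norm (F k u))" by simp
  have lim: "(\<Sum>k. F k u) = indicator {0<..<1} u *\<^sub>R (beta_density a b u * g u)" for u
  proof (cases "u \<in> {0<..<1}")
    case True
    thus ?thesis using sums_mult[OF sums[OF True], of "beta_density a b u"]
      by (simp add: pw sums_unique[symmetric])
  qed (auto simp: F_def)
  show "set_integrable lborel {0<..<1} (\<lambda>u. beta_density a b u * g u)"
    using integrable_suminf[OF int AE summ] by (simp add: lim set_integrable_def)
  have "integral\<^sup>L lborel (F k) = c k * (LINT u:{0<..<1}|lborel. beta_density (a + of_nat k) b u)" for k
    unfolding F_def set_lebesgue_integral_def by (rule integral_mult_right_zero)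
  thus "(\<lambda>k. c k * (LINT u:{0<..<1}|lborel. beta_density (a + of_nat k) b u)) sums
           (LINT u:{0<..<1}|lborel. beta_density a b u * g u)"
    using sums_integral[OF int AE summ] by (simp add: lim set_lebesgue_integral_def)
qed

lemma beta_density_1_right:
  assumes "Re a > 0"
  shows "(LINT u:{0<..<1}|lborel. beta_density a 1 u) = 1 / a"
proof -
  have "a \<noteq> 0" using assms by auto
  have "((\<lambda>u. of_real u powr (a - 1)) has_integral (of_real 1 powr a / a - of_real 0 powr a / a)) {0..1::real}"
  proof (rule fundamental_theorem_of_calculus_interior)
    show "continuous_on {0..1} (\<lambda>u. complex_of_real u powr a / a)"
      using assms \<open>a \<noteq> 0\<close> by (intro continuous_intros continuous_on_powr_complex) auto
    fix u :: real assume u: "u \<in> {0<..<1}"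
    have "((\<lambda>z. z powr a / a) has_field_derivative (of_real u powr (a - 1))) (at (of_real u))"
      using u \<open>a \<noteq> 0\<close> by (auto intro!: derivative_eq_intros simp: complex_nonpos_Reals_iff)
    thus "((\<lambda>u. complex_of_real u powr a / a) has_vector_derivative of_real u powr (a - 1)) (at u)"
      by (rule has_vector_derivative_real_field)
  qed auto
  hence "((\<lambda>u. of_real u powr (a - 1)) has_integral (1 / a)) {0<..<1::real}"
    by (simp add: has_integral_Icc_iff_Ioo)
  moreover have "beta_density a 1 u = of_real u powr (a - 1)" if "u \<in> {0<..<1}" for u
  proof -
    have "complex_of_real (1 - u) \<noteq> 0" using that unfolding of_real_eq_0_iff by simp
    thus ?thesis by (simp add: beta_density_def del: of_real_diff)
  qed
  ultimately have "(beta_density a 1 has_integral (1 / a)) {0<..<1}"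
    by (metis (no_types, lifting) has_integral_cong)
  moreover have "(LINT u:{0<..<1}|lborel. beta_density a 1 u) = integral {0<..<1} (beta_density a 1)"
    using beta_density_abs(1)[of a 1] assms by (intro set_borel_integral_eq_integral(2)) auto
  ultimately show ?thesis by (simp add: integral_unique)
qed

text \<open>
  Expand \<open>(1 - u)\<^sup>b\<^sup>-\<^sup>1\<close> into the binomial series and integrate against \<open>u\<^sup>a\<^sup>-\<^sup>1\<close>. The outcome is
  \<open>\<^sub>2F\<^sub>1(1 - b, a; a + 1; 1) / a\<close>, and Gauss's theorem applies since \<open>(a + 1) - (1 - b) - a = b\<close>.
\<close>
theorem integral_beta_density:
  assumes a: "Re a > 0" and b: "Re b > 0"
  shows "(LINT u:{0<..<1}|lborel. beta_density a b u) = Beta a b"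
proof -
  have a0: "a \<noteq> 0" "a \<notin> \<int>\<^sub>\<le>\<^sub>0" "a + 1 \<notin> \<int>\<^sub>\<le>\<^sub>0" using a notin_nonpos_Ints_if_Re_pos[of a] notin_nonpos_Ints_if_Re_pos[of "a + 1"] by auto
  define c where "c = (\<lambda>k. pochhammer (1 - b) k / fact k)"
  have c_hyp: "hyp_coeff (1 - b) 1 1 k = c k" for k
    by (simp add: hyp_coeff_def c_def pochhammer_fact[symmetric])
  have growth: "(\<lambda>k. norm (c k)) \<in> O(\<lambda>k. real k powr (- Re b))"
    using hyp_coeff_bigo[of 1 "1 - b" 1] unfolding c_hyp by simp
  have sums: "(\<lambda>k. c k * of_real u ^ k) sums (of_real (1 - u) powr (b - 1))" if "u \<in> {0<..<1}" for u :: real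
  proof -
    have "(\<lambda>k. ((b - 1) gchoose k) * (- of_real u) ^ k) sums (1 + (- of_real u)) powr (b - 1)"
      using that by (intro gen_binomial_complex) auto
    moreover have "((b - 1) gchoose k) * (- of_real u) ^ k = c k * of_real u ^ k" for k
    proof -
      have "(-1) ^ k * (- complex_of_real u) ^ k = of_real u ^ k"
        unfolding power_mult_distrib[symmetric] by simp
      moreover have "(b - 1) gchoose k = (-1) ^ k * c k"
        by (simp add: gbinomial_pochhammer c_def)
      ultimately show ?thesis by (metis mult.assoc mult.commute)
    qed
    ultimately show ?thesis by simp
  qed
  have abs: "summable (\<lambda>k. norm (c k) * u ^ k)" if "u \<in> {0<..<1}" for u :: real
  proof -
    \<comment> \<open>A power series that converges at \<open>v > u\<close> converges absolutely at \<open>u\<close>.\<close>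
    define v where "v = (1 + u) / 2"
    have v: "v \<in> {0<..<1}" "u < v" using that by (auto simp: v_def)
    have "summable (\<lambda>k. c k * of_real v ^ k)" using sums[OF v(1)] by (simp add: sums_iff)
    hence "summable (\<lambda>k. norm (c k * of_real u ^ k))"
      by (rule powser_insidea) (use that v in auto)
    thus ?thesis using that by (simp add: norm_mult norm_power)
  qed
  have "(\<lambda>k. c k * (LINT u:{0<..<1}|lborel. beta_density (a + of_nat k) 1 u)) sums
     (LINT u:{0<..<1}|lborel. beta_density a 1 u * of_real (1 - u) powr (b - 1))"
    by (rule beta_density_power_series(2)[OF a _ sums abs growth]) (use b in auto)
  moreover have "(LINT u:{0<..<1}|lborel. beta_density a 1 u * of_real (1 - u) powr (b - 1)) =
    (LINT u:{0<..<1}|lborel. beta_density a b u)"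
  proof (intro set_lebesgue_integral_cong allI impI)
    fix u :: real assume "u \<in> {0<..<1}"
    hence "complex_of_real (1 - u) \<noteq> 0" unfolding of_real_eq_0_iff by simp
    thus "beta_density a 1 u * of_real (1 - u) powr (b - 1) = beta_density a b u"
      by (simp add: beta_density_def del: of_real_diff)
  qed auto
  moreover have "c k * (LINT u:{0<..<1}|lborel. beta_density (a + of_nat k) 1 u) = hyp_coeff (1 - b) a (a + 1) k / a" for k
  proof -
    have "a + of_nat k \<noteq> 0" using a by (auto simp: complex_eq_iff)
    moreover have "pochhammer (a + 1) k \<noteq> 0" using a0 pochhammer_eq_0_imp_nonpos_Int by blast
    moreover have "pochhammer a k * (a + of_nat k) = a * pochhammer (a + 1) k"
      using pochhammer_rec[of a k] pochhammer_rec'[of a k] by (simp add: mult.commute)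
    ultimately show ?thesis using a a0
      by (simp add: beta_density_1_right c_def hyp_coeff_def divide_simps mult_ac)
  qed
  ultimately have "(\<lambda>k. hyp_coeff (1 - b) a (a + 1) k / a) sums (LINT u:{0<..<1}|lborel. beta_density a b u)"
    by (simp only:)
  moreover have "(\<lambda>k. hyp_coeff (1 - b) a (a + 1) k / a) sums
    (Gamma (a + 1) * Gamma (a + 1 - (1 - b) - a) * rGamma (a + 1 - (1 - b)) * rGamma (a + 1 - a) / a)"
    by (intro sums_divide gauss_hypergeometric) (use a0 b in auto)
  ultimately have "(LINT u:{0<..<1}|lborel. beta_density a b u) = 
    Gamma (a + 1) * Gamma (a + 1 - (1 - b) - a) * rGamma (a + 1 - (1 - b)) * rGamma (a + 1 - a) / a"
    by (rule sums_unique2)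
  also have "\<dots> = Beta a b" using a0 by (simp add: Beta_altdef Gamma_plus1)
  finally show ?thesis .
qed

section \<open>The Saigo integral of a power function\<close>

lemma summable_hyp_coeff_power:
  assumes c: "c \<notin> \<int>\<^sub>\<le>\<^sub>0" and u: "0 < u" "u < (1::real)"
  shows "summable (\<lambda>k. norm (hyp_coeff a b c k) * u ^ k)"
proof -
  define e where "e = Re (a + b - c) - 1"
  have "(\<lambda>k. norm (hyp_coeff a b c k) * u ^ k) \<in> O(\<lambda>k. real k powr e * u ^ k)"
    unfolding e_def by (rule landau_o.big.mult[OF hyp_coeff_bigo[OF c] landau_o.big_refl])
  moreover have "(\<lambda>k. real k powr e * u ^ k) \<in> O(\<lambda>k. real k powr (-2))"
    using u by real_asymp
  ultimately have "(\<lambda>k. norm (hyp_coeff a b c k) * u ^ k) \<in> O(\<lambda>k. real k powr (-2))"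
    by (rule landau_o.big_trans)
  thus ?thesis by (rule summable_bigo_powr) simp
qed

lemma hyp2F1_sums:
  assumes c: "c \<notin> \<int>\<^sub>\<le>\<^sub>0" and u: "0 < u" "u < (1::real)"
  shows "(\<lambda>k. hyp_coeff a b c k * of_real u ^ k) sums hyp2F1 a b c (of_real u)"
proof -
  have "summable (\<lambda>k. norm (hyp_coeff a b c k * of_real u ^ k))"
    using summable_hyp_coeff_power[OF assms, of a b] u by (simp add: norm_mult norm_power)
  hence "summable (\<lambda>k. hyp_coeff a b c k * of_real u ^ k)" by (rule summable_norm_cancel)
  thus ?thesis unfolding hyp2F1_def eval_fps_def fps_hypergeo_coeff by (rule summable_sums)
qed

text \<open>
  The \<open>k\<close>-th Beta integral is \<open>B(c, r)\<close> times the quotient of the Pochhammer symbols of \<open>c\<close> and \<open>c + r\<close>. So integration turns the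
  lower parameter \<open>c\<close> of the series into \<open>c + r\<close> and the argument into \<open>1\<close>.
\<close>
lemma integral_beta_density_hyp2F1:
  assumes c: "Re c > 0" and r: "Re r > 0" and re: "Re (c + r - a - b) > 0"
  shows "set_integrable lborel {0<..<1} (\<lambda>u. beta_density c r u * hyp2F1 a b c (of_real u))"
    and "(LINT u:{0<..<1}|lborel. beta_density c r u * hyp2F1 a b c (of_real u)) =
      Gamma c * Gamma r * Gamma (c + r - a - b) * rGamma (c + r - a) * rGamma (c + r - b)"
proof -
  have cn: "c \<notin> \<int>\<^sub>\<le>\<^sub>0" and crn: "c + r \<notin> \<int>\<^sub>\<le>\<^sub>0"
    using c r by (auto intro!: notin_nonpos_Ints_if_Re_pos)
  have sums: "(\<lambda>k. hyp_coeff a b c k * of_real u ^ k) sums hyp2F1 a b c (of_real u)" if "u \<in> {0<..<1}" for u :: real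
    using hyp2F1_sums[OF cn] that by auto
  have abs: "summable (\<lambda>k. norm (hyp_coeff a b c k) * u ^ k)" if "u \<in> {0<..<1}" for u :: real
    using summable_hyp_coeff_power[OF cn] that by auto
  have lt: "Re (a + b - c) - 1 < Re r - 1" using re by simp
  note * = beta_density_power_series[OF c r sums abs hyp_coeff_bigo[OF cn] lt]
  show "set_integrable lborel {0<..<1} (\<lambda>u. beta_density c r u * hyp2F1 a b c (of_real u))"
    by (rule *(1))
  have "hyp_coeff a b c k * (LINT u:{0<..<1}|lborel. beta_density (c + of_nat k) r u) =
      Beta c r * hyp_coeff a b (c + r) k" for k
  proof -
    have "(LINT u:{0<..<1}|lborel. beta_density (c + of_nat k) r u) = Beta c r * pochhammer c k / pochhammer (c + r) k"
      using c r by (subst integral_beta_density) (auto simp: Beta_plus_nat[OF cn crn])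
    moreover have "pochhammer c k \<noteq> 0" using cn pochhammer_eq_0_imp_nonpos_Int by blast
    ultimately show ?thesis by (simp add: hyp_coeff_def mult_ac)
  qed
  with *(2) have "(\<lambda>k. Beta c r * hyp_coeff a b (c + r) k) sums
      (LINT u:{0<..<1}|lborel. beta_density c r u * hyp2F1 a b c (of_real u))" by (simp only:)
  moreover have "(\<lambda>k. Beta c r * hyp_coeff a b (c + r) k) sums
     (Beta c r * (Gamma (c + r) * Gamma (c + r - a - b) * rGamma (c + r - a) * rGamma (c + r - b)))"
    by (intro sums_mult gauss_hypergeometric crn re)
  ultimately have "(LINT u:{0<..<1}|lborel. beta_density c r u * hyp2F1 a b c (of_real u)) =
     Beta c r * (Gamma (c + r) * Gamma (c + r - a - b) * rGamma (c + r - a) * rGamma (c + r - b))"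
    by (rule sums_unique2)
  thus "(LINT u:{0<..<1}|lborel. beta_density c r u * hyp2F1 a b c (of_real u)) =
      Gamma c * Gamma r * Gamma (c + r - a - b) * rGamma (c + r - a) * rGamma (c + r - b)"
    using crn by (simp add: Beta_def Gamma_eq_zero_iff)
qed

lemma saigo_integrand_rescale:
  assumes x: "x > 0"
  shows "indicator {0<..<x} (x + (-x) * u) *\<^sub>R
      saigo_integrand \<alpha> \<beta> \<gamma> (\<lambda>t. of_real t powr (\<rho> - 1)) x (x + (-x) * u) =
    of_real x powr (\<alpha> + \<rho> - 2) * (indicator {0<..<1} u *\<^sub>R
      (beta_density \<alpha> \<rho> u * hyp2F1 (\<alpha> + \<beta>) (-\<gamma>) \<alpha> (of_real u)))"
proof (cases "u \<in> {0<..<1}")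
  case True
  define t where "t = x + (-x) * u"
  have t: "t = x * (1 - u)" "x - t = x * u" "1 - t / x = u"
    using x by (simp_all add: t_def field_simps)
  have ind: "t \<in> {0<..<x}" using True x by (auto simp: t(1))
  have "saigo_integrand \<alpha> \<beta> \<gamma> (\<lambda>t. of_real t powr (\<rho> - 1)) x t =
      of_real (x * u) powr (\<alpha> - 1) * hyp2F1 (\<alpha> + \<beta>) (-\<gamma>) \<alpha> (of_real u) * of_real t powr (\<rho> - 1)"
    unfolding saigo_integrand_def t(2,3) ..
  also have "complex_of_real (x * u) powr (\<alpha> - 1) = of_real x powr (\<alpha> - 1) * of_real u powr (\<alpha> - 1)"
    unfolding of_real_mult using x True by (intro powr_times_real) auto
  also have "complex_of_real t powr (\<rho> - 1) = of_real x powr (\<rho> - 1) * of_real (1 - u) powr (\<rho> - 1)"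
    unfolding of_real_mult t(1) using x True by (intro powr_times_real) auto
  finally have "saigo_integrand \<alpha> \<beta> \<gamma> (\<lambda>t. of_real t powr (\<rho> - 1)) x t =
      (of_real x powr (\<alpha> - 1) * of_real x powr (\<rho> - 1)) *
      (beta_density \<alpha> \<rho> u * hyp2F1 (\<alpha> + \<beta>) (-\<gamma>) \<alpha> (of_real u))"
    unfolding beta_density_def by (simp only: mult_ac)
  moreover have "complex_of_real x powr (\<alpha> + \<rho> - 2) = of_real x powr (\<alpha> - 1) * of_real x powr (\<rho> - 1)"
    unfolding powr_add[symmetric] by (simp add: algebra_simps)
  ultimately show ?thesis using True ind unfolding t_def[symmetric] by simp
next
  case False
  hence "x + (-x) * u \<notin> {0<..<x}" using x by (auto simp: zero_less_mult_iff not_less algebra_simps mult_le_cancel_left1)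
  thus ?thesis using False by simp
qed

text \<open>
  The substitution \<open>t = x (1 - u)\<close> exchanges the two end points. The expression \<open>c + r - a - b\<close> of the
  integral over the unit interval becomes \<open>\<rho> + \<gamma> - \<beta>\<close>, which has positive real part by assumption.
\<close>
theorem saigo_kernel_power:
  assumes al: "Re \<alpha> > 0" and rho: "Re \<rho> > max 0 (Re (\<beta> - \<gamma>))" and x: "x > 0"
  shows "set_integrable lborel {0<..<x} (saigo_integrand \<alpha> \<beta> \<gamma> (\<lambda>t. of_real t powr (\<rho> - 1)) x)"
    and "(LINT t:{0<..<x}|lborel. saigo_integrand \<alpha> \<beta> \<gamma> (\<lambda>t. of_real t powr (\<rho> - 1)) x t) =
      of_real x powr (\<alpha> + \<rho> - 1) * (Gamma \<alpha> * Gamma \<rho> * Gamma (\<rho> + \<gamma> - \<beta>) * rGamma (\<rho> - \<beta>) * rGamma (\<alpha> + \<gamma> + \<rho>))"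
proof -
  let ?f = "saigo_integrand \<alpha> \<beta> \<gamma> (\<lambda>t. of_real t powr (\<rho> - 1)) x"
  let ?g = "\<lambda>u. beta_density \<alpha> \<rho> u * hyp2F1 (\<alpha> + \<beta>) (-\<gamma>) \<alpha> (of_real u)"
  have rho': "Re \<rho> > 0" "Re (\<alpha> + \<rho> - (\<alpha> + \<beta>) - (-\<gamma>)) > 0" using rho by auto
  note * = integral_beta_density_hyp2F1[OF al rho']
  have "integrable lborel (\<lambda>u. of_real x powr (\<alpha> + \<rho> - 2) * (indicator {0<..<1} u *\<^sub>R ?g u))"
    using *(1) by (intro integrable_mult_right) (simp add: set_integrable_def)
  hence "integrable lborel (\<lambda>u. indicator {0<..<x} (x + (-x) * u) *\<^sub>R ?f (x + (-x) * u))"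
    by (simp only: saigo_integrand_rescale[OF x])
  thus "set_integrable lborel {0<..<x} ?f"
    unfolding set_integrable_def using x by (subst (asm) lborel_integrable_real_affine_iff) auto
  have "(LINT t:{0<..<x}|lborel. ?f t) = \<bar>-x\<bar> *\<^sub>R (LINT u|lborel. indicator {0<..<x} (x + (-x) * u) *\<^sub>R ?f (x + (-x) * u))"
    unfolding set_lebesgue_integral_def using x by (intro lborel_integral_real_affine) auto
  also have "(LINT u|lborel. indicator {0<..<x} (x + (-x) * u) *\<^sub>R ?f (x + (-x) * u)) =
    of_real x powr (\<alpha> + \<rho> - 2) * (LINT u:{0<..<1}|lborel. ?g u)"
    unfolding saigo_integrand_rescale[OF x] set_lebesgue_integral_def by (rule integral_mult_right_zero)
  also have "(LINT u:{0<..<1}|lborel. ?g u) =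
     Gamma \<alpha> * Gamma \<rho> * Gamma (\<rho> + \<gamma> - \<beta>) * rGamma (\<rho> - \<beta>) * rGamma (\<alpha> + \<gamma> + \<rho>)"
    using *(2) by (simp add: algebra_simps)
  also have "\<bar>-x\<bar> *\<^sub>R (of_real x powr (\<alpha> + \<rho> - 2) * (Gamma \<alpha> * Gamma \<rho> * Gamma (\<rho> + \<gamma> - \<beta>) * rGamma (\<rho> - \<beta>) * rGamma (\<alpha> + \<gamma> + \<rho>))) =
    of_real x powr (\<alpha> + \<rho> - 1) * (Gamma \<alpha> * Gamma \<rho> * Gamma (\<rho> + \<gamma> - \<beta>) * rGamma (\<rho> - \<beta>) * rGamma (\<alpha> + \<gamma> + \<rho>))"
  proof -
    have "complex_of_real x powr (1 + (\<alpha> + \<rho> - 2)) = of_real x * of_real x powr (\<alpha> + \<rho> - 2)"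
      using x unfolding powr_add by simp
    moreover have "1 + (\<alpha> + \<rho> - 2) = \<alpha> + \<rho> - 1" by simp
    ultimately show ?thesis using x by (simp only: scaleR_conv_of_real) simp
  qed
  finally show "(LINT t:{0<..<x}|lborel. ?f t) =
      of_real x powr (\<alpha> + \<rho> - 1) * (Gamma \<alpha> * Gamma \<rho> * Gamma (\<rho> + \<gamma> - \<beta>) * rGamma (\<rho> - \<beta>) * rGamma (\<alpha> + \<gamma> + \<rho>))" .
qed

section \<open>The Gamma function on vertical lines\<close>

text \<open>
  This is \<open>ln |x + \<i> \<tau>|\<close>. The logarithms of the factors in Euler's product for \<open>\<Gamma>\<close> have this form.
\<close>
definition log_norm :: "real \<Rightarrow> real \<Rightarrow> real" where
  "log_norm \<tau> x = ln (x\<^sup>2 + \<tau>\<^sup>2) / 2"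

text \<open>
  From \<open>ln y \<le> y - 1\<close> for the quotient \<open>y\<close> of the two arguments of the logarithm. Applied with \<open>- u\<close> at \<open>x + u\<close> it also yields a
  lower bound for the same increment.
\<close>
lemma log_norm_increment_le:
  assumes "\<tau> \<noteq> 0"
  shows "log_norm \<tau> (x + u) - log_norm \<tau> x \<le> u * x / (x\<^sup>2 + \<tau>\<^sup>2) + u\<^sup>2 / (2 * (x\<^sup>2 + \<tau>\<^sup>2))"
proof -
  define d w where "d = x\<^sup>2 + \<tau>\<^sup>2" and "w = 2 * u * x + u\<^sup>2"
  have d: "d > 0" using assms by (simp add: d_def add_nonneg_pos)
  have dw: "(x + u)\<^sup>2 + \<tau>\<^sup>2 = d + w" by (simp add: d_def w_def power2_eq_square algebra_simps)
  have "d + w > 0" using assms unfolding dw[symmetric] by (simp add: add_nonneg_pos)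
  hence "ln (d + w) - ln d = ln ((d + w) / d)" using d by (simp only: ln_divide_pos)
  also have "\<dots> \<le> (d + w) / d - 1" using d \<open>d + w > 0\<close> by (intro ln_le_minus_one divide_pos_pos)
  also have "\<dots> = w / d" using d by (simp add: add_divide_distrib)
  also have "w / d = 2 * (u * x / d + u\<^sup>2 / (2 * d))" by (simp add: w_def add_divide_distrib)
  finally have le: "ln (d + w) - ln d \<le> 2 * (u * x / d + u\<^sup>2 / (2 * d))" .
  have half: "p / 2 - q / 2 \<le> r" if "p - q \<le> 2 * r" for p q r :: real using that by simp
  show ?thesis using half[OF le] unfolding log_norm_def dw by (simp only: d_def)
qed

text \<open>
  A first-order Taylor formula. The constant depends on \<open>u\<close> alone and the bound is summable over
  \<open>x = 0, 1, 2, \<dots>\<close>, uniformly in \<open>|\<tau>| \<ge> 1\<close>.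
\<close>
lemma log_norm_increment:
  assumes "\<bar>\<tau>\<bar> \<ge> 1"
  shows "\<bar>log_norm \<tau> (x + u) - log_norm \<tau> x - u * (x / (x\<^sup>2 + \<tau>\<^sup>2))\<bar> \<le> (u\<^sup>2 * (3 + \<bar>u\<bar>) * (1 + u\<^sup>2)) * (1 / (x\<^sup>2 + 1))"
proof -
  define D E where "D = x\<^sup>2 + \<tau>\<^sup>2" and "E = (x + u)\<^sup>2 + \<tau>\<^sup>2"
  have t1: "\<tau>\<^sup>2 \<ge> 1" using assms by (metis abs_le_square_iff abs_one one_power2)
  have t0: "\<tau> \<noteq> 0" using assms by auto
  have D1: "D \<ge> x\<^sup>2 + 1" "E \<ge> 1" using t1 zero_le_power2[of "x + u"] unfolding D_def E_def by linarith+
  have D0: "D > 0" "E > 0" using D1 zero_le_power2[of x] by linarith+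
  \<comment> \<open>Replaces the denominator at \<open>x + u\<close> by the one at \<open>x\<close>.\<close>
  have E_D: "1 / E \<le> 2 * (1 + u\<^sup>2) / D"
  proof -
    have "x\<^sup>2 \<le> 2 * (x + u)\<^sup>2 + 2 * u\<^sup>2"
      using zero_le_power2[of "x + 2 * u"] by (simp add: power2_eq_square algebra_simps)
    hence "D \<le> 2 * E + 2 * u\<^sup>2" using t1 by (simp add: D_def E_def)
    also have "\<dots> \<le> 2 * (1 + u\<^sup>2) * E" using mult_left_mono[OF D1(2), of "2 * u\<^sup>2"] by (simp add: distrib_left distrib_right)
    finally show ?thesis using D0 by (simp add: field_simps)
  qed
  have up: "log_norm \<tau> (x + u) - log_norm \<tau> x - u * (x / D) \<le> u\<^sup>2 / (2 * D)"
    using log_norm_increment_le[OF t0, of x u] by (simp add: D_def)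
  have low1: "log_norm \<tau> (x + u) - log_norm \<tau> x \<ge> u * (x + u) / E - u\<^sup>2 / (2 * E)"
    using log_norm_increment_le[OF t0, of "x + u" "- u"] by (simp add: E_def)
  have "u * (x + u) / E - u * (x / D) = u\<^sup>2 * (D - 2 * x\<^sup>2 - u * x) / (D * E)"
  proof -
    have "u * (x + u) * D - u * x * E = u\<^sup>2 * (D - 2 * x\<^sup>2 - u * x)"
      by (simp add: D_def E_def power2_eq_square algebra_simps)
    thus ?thesis using D0 by (simp add: diff_frac_eq mult_ac)
  qed
  moreover have "D - 2 * x\<^sup>2 - u * x \<ge> - (1 + \<bar>u\<bar> / 2) * D"
  proof -
    have "D - 2 * x\<^sup>2 \<ge> - D" by (simp add: D_def)
    moreover have "2 * \<bar>x\<bar> \<le> x\<^sup>2 + 1" using zero_le_power2[of "\<bar>x\<bar> - 1"] by (simp add: power2_eq_square algebra_simps)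
    hence "\<bar>x\<bar> \<le> D / 2" using D1 by simp
    hence "\<bar>u\<bar> * \<bar>x\<bar> \<le> \<bar>u\<bar> * (D / 2)" by (rule mult_left_mono) simp
    hence "u * x \<le> \<bar>u\<bar> * D / 2" using abs_ge_self[of "u * x"] by (simp add: abs_mult)
    ultimately show ?thesis by (simp add: algebra_simps)
  qed
  hence "u\<^sup>2 * (D - 2 * x\<^sup>2 - u * x) / (D * E) \<ge> u\<^sup>2 * (- (1 + \<bar>u\<bar> / 2) * D) / (D * E)"
    using D0 by (intro divide_right_mono mult_left_mono) auto
  ultimately have low: "log_norm \<tau> (x + u) - log_norm \<tau> x - u * (x / D) \<ge> - (u\<^sup>2 * (3 / 2 + \<bar>u\<bar> / 2)) * (1 / E)"
    using low1 D0 by (simp add: algebra_simps add_divide_distrib diff_divide_distrib)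
  have "- (u\<^sup>2 * (3 / 2 + \<bar>u\<bar> / 2)) * (1 / E) \<ge> - (u\<^sup>2 * (3 / 2 + \<bar>u\<bar> / 2)) * (2 * (1 + u\<^sup>2) / D)"
    using E_D by (intro mult_left_mono_neg) auto
  hence low': "log_norm \<tau> (x + u) - log_norm \<tau> x - u * (x / D) \<ge> - ((u\<^sup>2 * (3 + \<bar>u\<bar>) * (1 + u\<^sup>2)) * (1 / D))"
    using low by (simp add: algebra_simps add_divide_distrib)
  have "u\<^sup>2 * 1 * (1 / 2) \<le> u\<^sup>2 * (3 + \<bar>u\<bar>) * (1 + u\<^sup>2)"
    by (intro mult_mono) auto
  hence "u\<^sup>2 * (1 / 2) * (1 / D) \<le> u\<^sup>2 * (3 + \<bar>u\<bar>) * (1 + u\<^sup>2) * (1 / D)"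
    using D0 by (intro mult_right_mono) auto
  with up have up': "log_norm \<tau> (x + u) - log_norm \<tau> x - u * (x / D) \<le> (u\<^sup>2 * (3 + \<bar>u\<bar>) * (1 + u\<^sup>2)) * (1 / D)"
    by simp
  have "1 / D \<le> 1 / (x\<^sup>2 + 1)" using D1 D0 by (intro divide_left_mono mult_pos_pos) (auto simp: add_nonneg_pos)
  hence "(u\<^sup>2 * (3 + \<bar>u\<bar>) * (1 + u\<^sup>2)) * (1 / D) \<le> (u\<^sup>2 * (3 + \<bar>u\<bar>) * (1 + u\<^sup>2)) * (1 / (x\<^sup>2 + 1))"
    by (intro mult_left_mono) auto
  with low' up' show ?thesis unfolding D_def by linarith
qed

text \<open>
  Up to bounded errors, shifting the argument by \<open>u\<close> has \<open>u\<close> times the effect of shifting it by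
  \<open>1\<close>, since both are governed by the same sum of first derivatives. For the shift by \<open>1\<close> the sum
  telescopes.
\<close>
lemma log_norm_sum:
  fixes u :: real
  obtains M where "\<And>\<tau> N. \<bar>\<tau>\<bar> \<ge> 1 \<Longrightarrow>
    \<bar>(\<Sum>k<N. log_norm \<tau> (real k + u) - log_norm \<tau> (real k)) - u * (log_norm \<tau> (real N) - log_norm \<tau> 0)\<bar> \<le> M"
proof -
  define K where "K = (\<lambda>u::real. u\<^sup>2 * (3 + \<bar>u\<bar>) * (1 + u\<^sup>2))"
  define C where "C = (\<Sum>k. 1 / ((real k)\<^sup>2 + 1))"
  have summ: "summable (\<lambda>k. 1 / ((real k)\<^sup>2 + 1))"
  proof (rule summable_bigo_powr)
    show "(\<lambda>k. 1 / ((real k)\<^sup>2 + 1)) \<in> O(\<lambda>k. real k powr (-2))" by real_asymp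
  qed simp
  have K0: "K v \<ge> 0" for v unfolding K_def by simp
  have *: "\<bar>(\<Sum>k<N. log_norm \<tau> (real k + v) - log_norm \<tau> (real k)) - v * (\<Sum>k<N. real k / ((real k)\<^sup>2 + \<tau>\<^sup>2))\<bar> \<le> K v * C"
    if "\<bar>\<tau>\<bar> \<ge> 1" for \<tau> N v
  proof -
    have "\<bar>(\<Sum>k<N. log_norm \<tau> (real k + v) - log_norm \<tau> (real k)) - v * (\<Sum>k<N. real k / ((real k)\<^sup>2 + \<tau>\<^sup>2))\<bar> =
      \<bar>\<Sum>k<N. log_norm \<tau> (real k + v) - log_norm \<tau> (real k) - v * (real k / ((real k)\<^sup>2 + \<tau>\<^sup>2))\<bar>"
      by (simp only: sum_subtractf sum_distrib_left)
    also have "\<dots> \<le> (\<Sum>k<N. K v * (1 / ((real k)\<^sup>2 + 1)))"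
      unfolding K_def by (rule order_trans[OF sum_abs sum_mono]) (rule log_norm_increment[OF that])
    also have "\<dots> = K v * (\<Sum>k<N. 1 / ((real k)\<^sup>2 + 1))" by (simp only: sum_distrib_left)
    also have "\<dots> \<le> K v * C"
      unfolding C_def by (intro mult_left_mono sum_le_suminf summ K0) (auto simp: add_nonneg_pos)
    finally show ?thesis .
  qed
  show ?thesis
  proof (rule that)
    fix \<tau> :: real and N :: nat assume \<tau>: "\<bar>\<tau>\<bar> \<ge> 1"
    define H where "H = (\<Sum>k<N. real k / ((real k)\<^sup>2 + \<tau>\<^sup>2))"
    define S where "S = (\<Sum>k<N. log_norm \<tau> (real k + u) - log_norm \<tau> (real k))"
    have "(\<Sum>k<N. log_norm \<tau> (real k + 1) - log_norm \<tau> (real k)) = log_norm \<tau> (real N) - log_norm \<tau> 0"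
      using sum_lessThan_telescope[of "\<lambda>k. log_norm \<tau> (real k)" N] by (simp add: add.commute)
    hence 1: "\<bar>log_norm \<tau> (real N) - log_norm \<tau> 0 - H\<bar> \<le> K 1 * C"
      using *[OF \<tau>, where N = N and v = 1] by (simp add: H_def)
    have 2: "\<bar>S - u * H\<bar> \<le> K u * C" using *[OF \<tau>, where N = N and v = u] by (simp add: H_def S_def)
    have "S - u * (log_norm \<tau> (real N) - log_norm \<tau> 0) = (S - u * H) - u * (log_norm \<tau> (real N) - log_norm \<tau> 0 - H)"
      by (simp add: algebra_simps)
    also have "\<bar>\<dots>\<bar> \<le> \<bar>S - u * H\<bar> + \<bar>u\<bar> * \<bar>log_norm \<tau> (real N) - log_norm \<tau> 0 - H\<bar>"
      unfolding abs_mult[symmetric] by (rule abs_triangle_ineq4)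
    also have "\<dots> \<le> K u * C + \<bar>u\<bar> * (K 1 * C)"
      using 1 2 by (intro add_mono mult_left_mono) auto
    finally show "\<bar>(\<Sum>k<N. log_norm \<tau> (real k + u) - log_norm \<tau> (real k)) - u * (log_norm \<tau> (real N) - log_norm \<tau> 0)\<bar> \<le> K u * C + \<bar>u\<bar> * (K 1 * C)"
      unfolding S_def .
  qed
qed

lemma norm_rGamma_series_ratio:
  assumes "\<tau> \<noteq> 0" "N > 0"
  shows "norm (rGamma_series (Complex u \<tau>) N) / norm (rGamma_series (Complex 0 \<tau>) N) =
    exp ((\<Sum>k<Suc N. log_norm \<tau> (real k + u) - log_norm \<tau> (real k)) - u * ln (real N))"
proof -
  have nz: "Complex v \<tau> + of_nat k \<noteq> 0" for v k using assms by (simp add: complex_eq_iff)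
  have fac: "norm (Complex v \<tau> + of_nat k) = exp (log_norm \<tau> (real k + v))" for v k
  proof -
    have "(v + real k)\<^sup>2 + \<tau>\<^sup>2 > 0" using assms by (simp add: add_nonneg_pos)
    hence "exp (log_norm \<tau> (real k + v)) = sqrt ((v + real k)\<^sup>2 + \<tau>\<^sup>2)"
      by (simp add: log_norm_def add.commute flip: ln_sqrt)
    thus ?thesis by (simp add: cmod_def)
  qed
  have poch: "norm (pochhammer (Complex v \<tau>) (Suc N)) = exp (\<Sum>k<Suc N. log_norm \<tau> (real k + v))" for v
  proof -
    have "norm (pochhammer (Complex v \<tau>) (Suc N)) = (\<Prod>k<Suc N. norm (Complex v \<tau> + of_nat k))"
      unfolding pochhammer_prod prod_norm[symmetric] by (simp add: atLeast0LessThan)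
    also have "\<dots> = exp (\<Sum>k<Suc N. log_norm \<tau> (real k + v))"
      unfolding fac by (simp only: exp_sum finite_lessThan)
    finally show ?thesis .
  qed
  have R: "norm (rGamma_series (Complex v \<tau>) N) = exp ((\<Sum>k<Suc N. log_norm \<tau> (real k + v)) - v * ln (real N)) / fact N" for v
    using poch[of v] by (simp add: rGamma_series_def norm_divide norm_mult exp_diff del: sum.lessThan_Suc)
  have cancel: "exp X / fact N / (exp Y / fact N) = exp (X - Y)" for X Y :: real
    by (simp add: exp_diff)
  show ?thesis unfolding R cancel by (simp add: sum_subtractf del: sum.lessThan_Suc)
qed

text \<open>
  Pass to the limit in \<open>norm_rGamma_series_ratio\<close>. Of the telescoped sum
  \<open>u (ln |N + 1 + \<i> \<tau>| - ln |\<tau>|)\<close> the first part is cancelled by \<open>u ln N\<close> in the limit, and the second one is the power of \<open>|\<tau>|\<close>.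
\<close>
lemma norm_rGamma_vertical_ratio:
  fixes u :: real
  obtains M where "\<And>\<tau>. \<bar>\<tau>\<bar> \<ge> 1 \<Longrightarrow>
    exp (- M) * (norm (rGamma (Complex 0 \<tau>)) * \<bar>\<tau>\<bar> powr (- u)) \<le> norm (rGamma (Complex u \<tau>)) \<and>
    norm (rGamma (Complex u \<tau>)) \<le> exp M * (norm (rGamma (Complex 0 \<tau>)) * \<bar>\<tau>\<bar> powr (- u))"
proof -
  obtain M where M: "\<And>\<tau> N. \<bar>\<tau>\<bar> \<ge> 1 \<Longrightarrow>
    \<bar>(\<Sum>k<N. log_norm \<tau> (real k + u) - log_norm \<tau> (real k)) - u * (log_norm \<tau> (real N) - log_norm \<tau> 0)\<bar> \<le> M"
    using log_norm_sum[of u] by blast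
  show ?thesis
  proof (rule that)
    fix \<tau> :: real assume \<tau>: "\<bar>\<tau>\<bar> \<ge> 1"
    have nz: "\<tau> \<noteq> 0" using \<tau> by auto
    have "Complex 0 \<tau> \<notin> \<int>\<^sub>\<le>\<^sub>0"
      using nz by (auto simp: complex_eq_iff elim!: nonpos_Ints_cases)
    hence r0: "rGamma (Complex 0 \<tau>) \<noteq> 0" by (simp add: rGamma_eq_zero_iff)
    define R where "R = (\<lambda>N. norm (rGamma_series (Complex u \<tau>) N) / norm (rGamma_series (Complex 0 \<tau>) N))"
    define c where "c = (\<lambda>N. exp (u * (log_norm \<tau> (real (Suc N)) - ln (real N))) * \<bar>\<tau>\<bar> powr (- u))"
    have lnt: "log_norm \<tau> 0 = ln \<bar>\<tau>\<bar>" using nz ln_realpow[of "\<bar>\<tau>\<bar>" 2] by (simp add: log_norm_def)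
    have bd: "exp (- M) * c N \<le> R N \<and> R N \<le> exp M * c N" if "N > 0" for N
    proof -
      define S where "S = (\<Sum>k<Suc N. log_norm \<tau> (real k + u) - log_norm \<tau> (real k))"
      have "R N = exp (S - u * ln (real N))"
        unfolding R_def S_def by (rule norm_rGamma_series_ratio[OF nz that])
      moreover have "c N = exp (u * (log_norm \<tau> (real (Suc N)) - ln (real N)) - u * log_norm \<tau> 0)"
        using nz by (simp add: c_def lnt powr_def exp_diff exp_minus divide_inverse)
      moreover have "\<bar>S - u * (log_norm \<tau> (real (Suc N)) - log_norm \<tau> 0)\<bar> \<le> M"
        unfolding S_def by (rule M[OF \<tau>])
      ultimately show ?thesis by (simp add: algebra_simps abs_le_iff flip: exp_add)
    qed
    have R: "R \<longlonglongrightarrow> norm (rGamma (Complex u \<tau>)) / norm (rGamma (Complex 0 \<tau>))"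
      unfolding R_def by (intro tendsto_intros) (use r0 in auto)
    have "(\<lambda>N. log_norm \<tau> (real (Suc N)) - ln (real N)) \<longlonglongrightarrow> 0"
      unfolding log_norm_def by real_asymp
    hence "c \<longlonglongrightarrow> exp (u * 0) * \<bar>\<tau>\<bar> powr (- u)"
      unfolding c_def by (intro tendsto_mult tendsto_exp tendsto_const)
    hence c: "c \<longlonglongrightarrow> \<bar>\<tau>\<bar> powr (- u)" by simp
    have ev: "\<forall>\<^sub>F N in sequentially. exp (- M) * c N \<le> R N" "\<forall>\<^sub>F N in sequentially. R N \<le> exp M * c N"
      using bd by (auto intro: eventually_mono[OF eventually_gt_at_top[of 0]])
    have "exp (- M) * \<bar>\<tau>\<bar> powr (- u) \<le> norm (rGamma (Complex u \<tau>)) / norm (rGamma (Complex 0 \<tau>))"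
      by (rule tendsto_le[OF _ R tendsto_mult[OF tendsto_const c] ev(1)]) simp
    moreover have "norm (rGamma (Complex u \<tau>)) / norm (rGamma (Complex 0 \<tau>)) \<le> exp M * \<bar>\<tau>\<bar> powr (- u)"
      by (rule tendsto_le[OF _ tendsto_mult[OF tendsto_const c] R ev(2)]) simp
    ultimately show "exp (- M) * (norm (rGamma (Complex 0 \<tau>)) * \<bar>\<tau>\<bar> powr (- u)) \<le> norm (rGamma (Complex u \<tau>)) \<and>
      norm (rGamma (Complex u \<tau>)) \<le> exp M * (norm (rGamma (Complex 0 \<tau>)) * \<bar>\<tau>\<bar> powr (- u))"
      using r0 by (simp add: field_simps)
  qed
qed

text \<open>
  The reflection formula, where \<open>\<Gamma>(- z)\<close> is the conjugate of \<open>\<Gamma>(z)\<close> on the imaginary axis.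
\<close>
lemma norm_rGamma_imaginary_axis:
  "norm (rGamma (Complex 0 \<tau>)) ^ 2 = \<bar>\<tau>\<bar> * \<bar>sinh (pi * \<tau>)\<bar> / pi"
proof -
  define z where "z = Complex 0 \<tau>"
  have z: "z = \<i> * of_real \<tau>" by (simp add: z_def complex_eq_iff)
  have "cnj z = - z" by (simp add: z_def complex_eq_iff)
  hence "norm (rGamma z) = norm (rGamma (- z))" using cnj_rGamma[of z] complex_mod_cnj[of "rGamma z"] by simp
  also have "rGamma (- z) = - z * rGamma (1 - z)" using rGamma_plus1[of "- z"] by (simp add: add.commute)
  finally have "norm (rGamma z) ^ 2 = norm z * norm (rGamma z * rGamma (1 - z))"
    by (simp add: power2_eq_square norm_mult)
  also have "rGamma z * rGamma (1 - z) = sin (of_real pi * z) / of_real pi" by (rule rGamma_reflection_complex)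
  also have "sin (of_real pi * z) = \<i> * of_real (sinh (pi * \<tau>))"
  proof -
    have "of_real pi * z = \<i> * of_real (pi * \<tau>)" by (simp add: z)
    thus ?thesis by (simp add: complex_eq_iff Re_sin Im_sin sinh_def)
  qed
  finally show ?thesis by (simp add: z_def[symmetric]) (simp add: z norm_mult norm_divide)
qed

text \<open>
  Stirling's formula on a vertical line, up to constants: the imaginary axis is explicit, and other
  lines are compared with it.
\<close>
theorem norm_rGamma_vertical:
  "(\<lambda>\<tau>. norm (rGamma (Complex u \<tau>))) \<in> \<Theta>[at_infinity](\<lambda>\<tau>. \<bar>\<tau>\<bar> powr (1 / 2 - u) * exp (pi / 2 * \<bar>\<tau>\<bar>))"
proof -
  obtain M where M: "\<And>\<tau>. \<bar>\<tau>\<bar> \<ge> 1 \<Longrightarrow>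
    exp (- M) * (norm (rGamma (Complex 0 \<tau>)) * \<bar>\<tau>\<bar> powr (- u)) \<le> norm (rGamma (Complex u \<tau>)) \<and>
    norm (rGamma (Complex u \<tau>)) \<le> exp M * (norm (rGamma (Complex 0 \<tau>)) * \<bar>\<tau>\<bar> powr (- u))"
    using norm_rGamma_vertical_ratio[of u] by blast
  have ev: "\<forall>\<^sub>F \<tau>::real in at_infinity. \<bar>\<tau>\<bar> \<ge> 1"
    unfolding eventually_at_infinity by auto
  have base: "(\<lambda>\<tau>. norm (rGamma (Complex 0 \<tau>))) \<in> \<Theta>[at_infinity](\<lambda>\<tau>. \<bar>\<tau>\<bar> powr (1 / 2) * exp (pi / 2 * \<bar>\<tau>\<bar>))"
  proof (rule bigthetaI'[of "sqrt (1 / (4 * pi))" "sqrt (1 / (2 * pi))"])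
    show "\<forall>\<^sub>F \<tau> in at_infinity.
      sqrt (1 / (4 * pi)) * norm (\<bar>\<tau>\<bar> powr (1 / 2) * exp (pi / 2 * \<bar>\<tau>\<bar>)) \<le> norm (norm (rGamma (Complex 0 \<tau>))) \<and>
      norm (norm (rGamma (Complex 0 \<tau>))) \<le> sqrt (1 / (2 * pi)) * norm (\<bar>\<tau>\<bar> powr (1 / 2) * exp (pi / 2 * \<bar>\<tau>\<bar>))"
      using ev
    proof eventually_elim
      case (elim \<tau>)
      define g where "g = \<bar>\<tau>\<bar> * exp (pi * \<bar>\<tau>\<bar>)"
      have g: "\<bar>\<tau>\<bar> powr (1 / 2) * exp (pi / 2 * \<bar>\<tau>\<bar>) = sqrt g"
      proof -
        have "exp (pi / 2 * \<bar>\<tau>\<bar>) = sqrt (exp (pi * \<bar>\<tau>\<bar>))"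
          by (rule real_sqrt_unique[symmetric]) (auto simp: power2_eq_square simp flip: exp_add)
        thus ?thesis by (simp add: g_def powr_half_sqrt real_sqrt_mult)
      qed
      \<comment> \<open>The constants come from \<open>exp y / 4 \<le> sinh y \<le> exp y / 2\<close> at \<open>y = \<pi> |\<tau>|\<close>.\<close>
      have "pi * \<bar>\<tau>\<bar> \<ge> 3 * 1" using elim pi_gt3 by (intro mult_mono) auto
      hence big: "exp (pi * \<bar>\<tau>\<bar>) \<ge> 4" using exp_ge_add_one_self[of "pi * \<bar>\<tau>\<bar>"] by linarith
      have sm: "exp (- (pi * \<bar>\<tau>\<bar>)) \<le> 1" by simp
      have "sinh (pi * \<bar>\<tau>\<bar>) \<ge> 0" by simp
      moreover have "sinh (pi * \<tau>) = sinh (pi * \<bar>\<tau>\<bar>) \<or> sinh (pi * \<tau>) = - sinh (pi * \<bar>\<tau>\<bar>)"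
        by (cases "\<tau> \<ge> 0") auto
      ultimately have "\<bar>sinh (pi * \<tau>)\<bar> = sinh (pi * \<bar>\<tau>\<bar>)" by linarith
      hence sinh: "\<bar>sinh (pi * \<tau>)\<bar> = (exp (pi * \<bar>\<tau>\<bar>) - exp (- (pi * \<bar>\<tau>\<bar>))) / 2"
        by (simp add: sinh_field_def)
      have s1: "\<bar>sinh (pi * \<tau>)\<bar> \<ge> exp (pi * \<bar>\<tau>\<bar>) / 4" 
      proof -
        have "e / 4 \<le> (e - e') / 2" if "e \<ge> 4" "e' \<le> 1" for e e' :: real
          using that by (simp add: field_simps)
        thus ?thesis unfolding sinh using big sm by blast
      qed
      have s2: "\<bar>sinh (pi * \<tau>)\<bar> \<le> exp (pi * \<bar>\<tau>\<bar>) / 2" unfolding sinh by simp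
      have r: "norm (rGamma (Complex 0 \<tau>)) = sqrt (\<bar>\<tau>\<bar> * \<bar>sinh (pi * \<tau>)\<bar> / pi)"
        by (rule real_sqrt_unique[symmetric]) (auto simp: norm_rGamma_imaginary_axis)
      have "\<bar>\<tau>\<bar> * (exp (pi * \<bar>\<tau>\<bar>) / 4) \<le> \<bar>\<tau>\<bar> * \<bar>sinh (pi * \<tau>)\<bar>" using s1 by (intro mult_left_mono) auto
      hence "1 / (4 * pi) * g \<le> \<bar>\<tau>\<bar> * \<bar>sinh (pi * \<tau>)\<bar> / pi" by (simp add: g_def field_simps)
      moreover have "\<bar>\<tau>\<bar> * \<bar>sinh (pi * \<tau>)\<bar> \<le> \<bar>\<tau>\<bar> * (exp (pi * \<bar>\<tau>\<bar>) / 2)" using s2 by (intro mult_left_mono) auto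
      hence "\<bar>\<tau>\<bar> * \<bar>sinh (pi * \<tau>)\<bar> / pi \<le> 1 / (2 * pi) * g" by (simp add: g_def field_simps)
      moreover have "g \<ge> 0" by (simp add: g_def)
      ultimately show ?case unfolding g r by (simp only: real_norm_def abs_of_nonneg real_sqrt_ge_zero norm_ge_zero flip: real_sqrt_mult) auto
    qed
  qed auto
  have "(\<lambda>\<tau>. norm (rGamma (Complex u \<tau>))) \<in> \<Theta>[at_infinity](\<lambda>\<tau>. norm (rGamma (Complex 0 \<tau>)) * \<bar>\<tau>\<bar> powr (- u))"
    by (rule bigthetaI'[of "exp (- M)" "exp M"]) (use M in \<open>auto intro!: eventually_mono[OF ev]\<close>)
  also have "(\<lambda>\<tau>. norm (rGamma (Complex 0 \<tau>)) * \<bar>\<tau>\<bar> powr (- u)) \<in>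
      \<Theta>[at_infinity](\<lambda>\<tau>. (\<bar>\<tau>\<bar> powr (1 / 2) * exp (pi / 2 * \<bar>\<tau>\<bar>)) * \<bar>\<tau>\<bar> powr (- u))"
    by (rule landau_theta.mult[OF base bigtheta_refl])
  also have "(\<lambda>\<tau>. (\<bar>\<tau>\<bar> powr (1 / 2) * exp (pi / 2 * \<bar>\<tau>\<bar>)) * \<bar>\<tau>\<bar> powr (- u)) = (\<lambda>\<tau>. \<bar>\<tau>\<bar> powr (1 / 2 - u) * exp (pi / 2 * \<bar>\<tau>\<bar>))"
  proof
    fix \<tau> :: real
    have "\<bar>\<tau>\<bar> powr (1 / 2 - u) = \<bar>\<tau>\<bar> powr (1 / 2) * \<bar>\<tau>\<bar> powr (- u)"
      unfolding powr_add[symmetric] by simp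
    thus "(\<bar>\<tau>\<bar> powr (1 / 2) * exp (pi / 2 * \<bar>\<tau>\<bar>)) * \<bar>\<tau>\<bar> powr (- u) = \<bar>\<tau>\<bar> powr (1 / 2 - u) * exp (pi / 2 * \<bar>\<tau>\<bar>)"
      by (simp only: mult_ac)
  qed
  finally show ?thesis .
qed

section \<open>Size of the integrand of the I-function\<close>

text \<open>
  The family is closed under products, inverses and real powers. Estimates for \<open>\<chi>\<close> therefore
  reduce to adding up the two exponents.
\<close>
definition exp_growth :: "real \<Rightarrow> real \<Rightarrow> real \<Rightarrow> real" where
  "exp_growth p q \<tau> = \<bar>\<tau>\<bar> powr p * exp (q * \<bar>\<tau>\<bar>)"

lemma exp_growth_mult: "exp_growth p q \<tau> * exp_growth p' q' \<tau> = exp_growth (p + p') (q + q') \<tau>"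
  unfolding exp_growth_def powr_add distrib_right exp_add by (simp only: mult_ac)

lemma exp_growth_inverse: "inverse (exp_growth p q \<tau>) = exp_growth (- p) (- q) \<tau>"
  by (simp only: exp_growth_def powr_minus exp_minus inverse_mult_distrib mult_minus_left)

lemma exp_growth_powr: "exp_growth p q \<tau> powr k = exp_growth (k * p) (k * q) \<tau>"
proof -
  have "exp (q * \<bar>\<tau>\<bar>) powr k = exp (k * q * \<bar>\<tau>\<bar>)" by (simp add: powr_def mult_ac)
  thus ?thesis by (simp add: exp_growth_def powr_mult powr_powr mult.commute)
qed

lemma exp_growth_nonneg: "exp_growth p q \<tau> \<ge> 0"
  by (simp add: exp_growth_def)

lemma one_bigtheta_exp_growth: "(\<lambda>_. 1) \<in> \<Theta>[at_infinity](exp_growth 0 0)"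
proof (rule bigthetaI_cong)
  have "\<forall>\<^sub>F \<tau>::real in at_infinity. \<bar>\<tau>\<bar> \<ge> 1" unfolding eventually_at_infinity by auto
  thus "\<forall>\<^sub>F \<tau> in at_infinity. 1 = exp_growth 0 0 \<tau>"
    by (rule eventually_mono) (auto simp: exp_growth_def)
qed

lemma bigtheta_exp_growth_prod_list:
  assumes "\<And>x. x \<in> set xs \<Longrightarrow> f x \<in> \<Theta>[at_infinity](exp_growth (p x) (q x))"
  shows "(\<lambda>\<tau>. \<Prod>x\<leftarrow>xs. f x \<tau>) \<in> \<Theta>[at_infinity](exp_growth (\<Sum>x\<leftarrow>xs. p x) (\<Sum>x\<leftarrow>xs. q x))"
  using assms
proof (induction xs)
  case (Cons x xs)
  have "(\<lambda>\<tau>. f x \<tau> * (\<Prod>x\<leftarrow>xs. f x \<tau>)) \<in>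
    \<Theta>[at_infinity](\<lambda>\<tau>. exp_growth (p x) (q x) \<tau> * exp_growth (\<Sum>x\<leftarrow>xs. p x) (\<Sum>x\<leftarrow>xs. q x) \<tau>)"
    by (rule landau_theta.mult) (use Cons in auto)
  thus ?case by (simp add: exp_growth_mult)
qed (simp add: one_bigtheta_exp_growth)

lemma filterlim_affine_at_infinity:
  fixes v d :: real
  assumes "d \<noteq> 0"
  shows "filterlim (\<lambda>\<tau>. v + d * \<tau>) at_infinity at_infinity"
  by (intro tendsto_add_filterlim_at_infinity[OF tendsto_const]
      tendsto_mult_filterlim_at_infinity[OF tendsto_const assms] filterlim_ident)

lemma exp_growth_affine:
  assumes d: "d \<noteq> 0"
  shows "(\<lambda>\<tau>. exp_growth p q (v + d * \<tau>)) \<in> \<Theta>[at_infinity](exp_growth p (q * \<bar>d\<bar>))"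
proof -
  have abs: "(\<lambda>\<tau>. \<bar>v + d * \<tau>\<bar>) \<in> \<Theta>[at_infinity](\<lambda>\<tau>. \<bar>\<tau>\<bar>)"
  proof (rule bigthetaI'[of "\<bar>d\<bar> / 2" "\<bar>d\<bar> + \<bar>v\<bar>"])
    have "\<forall>\<^sub>F \<tau> in at_infinity. \<bar>\<tau>\<bar> \<ge> max 1 (2 * \<bar>v\<bar> / \<bar>d\<bar>)"
      unfolding eventually_at_infinity real_norm_def by blast
    thus "\<forall>\<^sub>F \<tau> in at_infinity. \<bar>d\<bar> / 2 * norm \<bar>\<tau>\<bar> \<le> norm \<bar>v + d * \<tau>\<bar> \<and> norm \<bar>v + d * \<tau>\<bar> \<le> (\<bar>d\<bar> + \<bar>v\<bar>) * norm \<bar>\<tau>\<bar>"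
    proof eventually_elim
      case (elim \<tau>)
      have "2 * \<bar>v\<bar> \<le> \<bar>d\<bar> * \<bar>\<tau>\<bar>" using elim d by (simp add: field_simps)
      moreover have "\<bar>d * \<tau>\<bar> - \<bar>v\<bar> \<le> \<bar>v + d * \<tau>\<bar>" "\<bar>v + d * \<tau>\<bar> \<le> \<bar>v\<bar> + \<bar>d * \<tau>\<bar>" by linarith+
      moreover have "\<bar>d * \<tau>\<bar> = \<bar>d\<bar> * \<bar>\<tau>\<bar>" by (rule abs_mult)
      moreover have "\<bar>v\<bar> \<le> \<bar>v\<bar> * \<bar>\<tau>\<bar>" using mult_left_mono[of 1 "\<bar>\<tau>\<bar>" "\<bar>v\<bar>"] elim by simp
      ultimately show ?case unfolding real_norm_def abs_idempotent distrib_right by linarith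
    qed
  qed (use d in \<open>auto simp: add_pos_nonneg\<close>)
  have pow: "(\<lambda>\<tau>. \<bar>v + d * \<tau>\<bar> powr p) \<in> \<Theta>[at_infinity](\<lambda>\<tau>. \<bar>\<tau>\<bar> powr p)"
    using bigtheta_powr[OF abs, of p] by (simp only: abs_idempotent)
  have exp: "(\<lambda>\<tau>. exp (q * \<bar>v + d * \<tau>\<bar>)) \<in> \<Theta>[at_infinity](\<lambda>\<tau>. exp (q * \<bar>d\<bar> * \<bar>\<tau>\<bar>))"
  proof (rule bigthetaI'[of "exp (- \<bar>q * v\<bar>)" "exp \<bar>q * v\<bar>"])
    have "exp (- \<bar>q * v\<bar>) * norm (exp (q * \<bar>d\<bar> * \<bar>\<tau>\<bar>)) \<le> norm (exp (q * \<bar>v + d * \<tau>\<bar>)) \<and>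
      norm (exp (q * \<bar>v + d * \<tau>\<bar>)) \<le> exp \<bar>q * v\<bar> * norm (exp (q * \<bar>d\<bar> * \<bar>\<tau>\<bar>))" for \<tau>
    proof -
      have "\<bar>\<bar>v + d * \<tau>\<bar> - \<bar>d\<bar> * \<bar>\<tau>\<bar>\<bar> \<le> \<bar>v\<bar>" unfolding abs_mult[symmetric] by linarith
      hence "\<bar>q\<bar> * \<bar>\<bar>v + d * \<tau>\<bar> - \<bar>d\<bar> * \<bar>\<tau>\<bar>\<bar> \<le> \<bar>q\<bar> * \<bar>v\<bar>" by (rule mult_left_mono) simp
      hence "\<bar>q * \<bar>v + d * \<tau>\<bar> - q * \<bar>d\<bar> * \<bar>\<tau>\<bar>\<bar> \<le> \<bar>q * v\<bar>"
        unfolding abs_mult[symmetric, of q] by (simp only: right_diff_distrib mult.assoc)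
      hence "- \<bar>q * v\<bar> + q * \<bar>d\<bar> * \<bar>\<tau>\<bar> \<le> q * \<bar>v + d * \<tau>\<bar>" "q * \<bar>v + d * \<tau>\<bar> \<le> \<bar>q * v\<bar> + q * \<bar>d\<bar> * \<bar>\<tau>\<bar>"
        by linarith+
      thus ?thesis unfolding real_norm_def abs_exp_cancel exp_add[symmetric] exp_le_cancel_iff by blast
    qed
    thus "\<forall>\<^sub>F \<tau> in at_infinity. exp (- \<bar>q * v\<bar>) * norm (exp (q * \<bar>d\<bar> * \<bar>\<tau>\<bar>)) \<le> norm (exp (q * \<bar>v + d * \<tau>\<bar>)) \<and>
      norm (exp (q * \<bar>v + d * \<tau>\<bar>)) \<le> exp \<bar>q * v\<bar> * norm (exp (q * \<bar>d\<bar> * \<bar>\<tau>\<bar>))"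
      by (intro always_eventually allI)
  qed auto
  show ?thesis unfolding exp_growth_def by (rule landau_theta.mult[OF pow exp])
qed

text \<open>
  The reciprocal Gamma function is entire, so this function is defined and continuous on the whole line for \<open>\<kappa> > 0\<close>, even if the
  line hits a pole of \<open>\<Gamma>\<close>.
\<close>
definition rGamma_abs_pow :: "complex \<Rightarrow> real \<Rightarrow> real \<Rightarrow> real \<Rightarrow> real" where
  "rGamma_abs_pow c d \<kappa> \<tau> = norm (rGamma (c + of_real d * (\<i> * of_real \<tau>))) powr \<kappa>"

lemma rGamma_abs_pow_bigtheta:
  assumes "d \<noteq> 0"
  shows "rGamma_abs_pow c d \<kappa> \<in> \<Theta>[at_infinity](exp_growth (\<kappa> * (1 / 2 - Re c)) (pi / 2 * (\<kappa> * \<bar>d\<bar>)))"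
proof -
  have eq: "c + of_real d * (\<i> * of_real \<tau>) = Complex (Re c) (Im c + d * \<tau>)" for \<tau>
    by (simp add: complex_eq_iff)
  have "(\<lambda>\<tau>. norm (rGamma (Complex (Re c) (Im c + d * \<tau>)))) \<in> \<Theta>[at_infinity](\<lambda>\<tau>. exp_growth (1 / 2 - Re c) (pi / 2) (Im c + d * \<tau>))"
    unfolding exp_growth_def
    by (rule landau_theta.compose[OF norm_rGamma_vertical filterlim_affine_at_infinity[OF assms]])
  also note exp_growth_affine[OF assms]
  finally have "(\<lambda>\<tau>. norm (rGamma (Complex (Re c) (Im c + d * \<tau>))) powr \<kappa>) \<in>
      \<Theta>[at_infinity](\<lambda>\<tau>. exp_growth (1 / 2 - Re c) (pi / 2 * \<bar>d\<bar>) \<tau> powr \<kappa>)"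
    by (drule_tac p = \<kappa> in bigtheta_powr) (simp only: abs_of_nonneg[OF exp_growth_nonneg] abs_norm_cancel)
  thus ?thesis unfolding rGamma_abs_pow_def eq exp_growth_powr by (simp add: mult_ac)
qed

lemma continuous_rGamma_abs_pow:
  assumes "\<kappa> > 0"
  shows "continuous_on UNIV (rGamma_abs_pow c d \<kappa>)"
proof -
  have "continuous_on UNIV (\<lambda>\<tau>. rGamma (c + of_real d * (\<i> * complex_of_real \<tau>)))"
    by (rule continuous_on_compose2[OF continuous_on_rGamma[of UNIV]]) (auto intro!: continuous_intros)
  thus ?thesis unfolding rGamma_abs_pow_def
    by (intro continuous_on_powr' continuous_on_norm continuous_on_const) (use assms in auto)
qed

text \<open>
  The modulus does not depend on the branch, because the exponent \<open>\<kappa>\<close> is real. At a pole both sides are \<open>0\<close>.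
\<close>
lemma norm_Gamma_pow:
  assumes "gamma_branch \<Lambda>"
  shows "norm (Gamma_pow \<Lambda> c d \<kappa> (\<i> * of_real \<tau>)) = inverse (rGamma_abs_pow c d \<kappa> \<tau>)"
proof (cases "c + of_real d * (\<i> * of_real \<tau>) \<in> \<int>\<^sub>\<le>\<^sub>0")
  case True
  thus ?thesis by (simp add: Gamma_pow_def rGamma_abs_pow_def rGamma_eq_zero_iff[THEN iffD2])
next
  case False
  define s where "s = \<i> * complex_of_real \<tau>"
  have s: "Re s = 0" "c + of_real d * s \<notin> \<int>\<^sub>\<le>\<^sub>0" using False by (simp_all add: s_def)
  hence E: "exp (\<Lambda> c d \<kappa> s) = Gamma (c + of_real d * s)" using assms unfolding gamma_branch_def by blast
  have "inverse (norm (rGamma (c + of_real d * s))) = exp (Re (\<Lambda> c d \<kappa> s))"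
    unfolding norm_exp_eq_Re[symmetric] E by (simp add: rGamma_inverse_Gamma norm_inverse)
  hence "norm (rGamma (c + of_real d * s)) = exp (- Re (\<Lambda> c d \<kappa> s))"
    by (metis exp_minus inverse_inverse_eq)
  hence "rGamma_abs_pow c d \<kappa> \<tau> = exp (- (\<kappa> * Re (\<Lambda> c d \<kappa> s)))"
    unfolding rGamma_abs_pow_def s_def[symmetric] by (simp add: powr_def)
  thus ?thesis using s(2) unfolding Gamma_pow_def s_def[symmetric] by (simp add: exp_minus)
qed

text \<open>
  For the exponent \<open>1\<close> the branch disappears, which is the case for the four additional triples.
\<close>
lemma Gamma_pow_1:
  assumes "gamma_branch \<Lambda>"
  shows "Gamma_pow \<Lambda> c d 1 (\<i> * of_real \<tau>) = Gamma (c + of_real d * (\<i> * of_real \<tau>))"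
proof (cases "c + of_real d * (\<i> * of_real \<tau>) \<in> \<int>\<^sub>\<le>\<^sub>0")
  case True
  thus ?thesis by (simp add: Gamma_pow_def Gamma_eq_zero_iff[THEN iffD2])
next
  case False
  moreover have "Re (\<i> * complex_of_real \<tau>) = 0" by simp
  ultimately have "exp (\<Lambda> c d 1 (\<i> * of_real \<tau>)) = Gamma (c + of_real d * (\<i> * of_real \<tau>))"
    using assms unfolding gamma_branch_def by blast
  thus ?thesis using False by (simp add: Gamma_pow_def)
qed

lemma measurable_Gamma_pow:
  assumes "gamma_branch \<Lambda>"
  shows "(\<lambda>\<tau>. Gamma_pow \<Lambda> c d \<kappa> (\<i> * of_real \<tau>)) \<in> borel_measurable borel"
proof -
  \<comment> \<open>The branch of the logarithm is only known to be continuous off this closed set.\<close>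
  define A where "A = (\<lambda>\<tau>. c + of_real d * (\<i> * complex_of_real \<tau>)) -` \<int>\<^sub>\<le>\<^sub>0"
  have "closed A" unfolding A_def by (intro closed_vimage closed_nonpos_Ints continuous_intros)
  hence "A \<in> sets borel" by simp
  moreover have "continuous_on (- A) (\<lambda>\<tau>. exp (of_real \<kappa> * \<Lambda> c d \<kappa> (\<i> * of_real \<tau>)))"
  proof (intro continuous_intros)
    have "continuous_on {s. Re s = 0 \<and> c + of_real d * s \<notin> \<int>\<^sub>\<le>\<^sub>0} (\<Lambda> c d \<kappa>)"
      using assms unfolding gamma_branch_def by blast
    thus "continuous_on (- A) (\<lambda>\<tau>. \<Lambda> c d \<kappa> (\<i> * of_real \<tau>))"
      by (rule continuous_on_compose2) (auto simp: A_def intro!: continuous_intros)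
  qed
  ultimately have "(\<lambda>\<tau>. if \<tau> \<in> A then 0 else exp (of_real \<kappa> * \<Lambda> c d \<kappa> (\<i> * of_real \<tau>))) \<in> borel_measurable borel"
    by (intro borel_measurable_continuous_on_if) auto
  thus ?thesis by (simp add: Gamma_pow_def A_def)
qed

lemma measurable_prod_list:
  fixes f :: "'b \<Rightarrow> 'a \<Rightarrow> complex"
  assumes "\<And>x. x \<in> set xs \<Longrightarrow> f x \<in> borel_measurable M"
  shows "(\<lambda>t. \<Prod>x\<leftarrow>xs. f x t) \<in> borel_measurable M"
  using assms by (induction xs) auto

lemma continuous_on_prod_list:
  fixes f :: "'b \<Rightarrow> 'a :: topological_space \<Rightarrow> real"
  assumes "\<And>x. x \<in> set xs \<Longrightarrow> continuous_on A (f x)"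
  shows "continuous_on A (\<lambda>t. \<Prod>x\<leftarrow>xs. f x t)"
  using assms by (induction xs) (auto intro!: continuous_intros)

lemma norm_prod_list:
  fixes f :: "'b \<Rightarrow> complex"
  shows "norm (\<Prod>x\<leftarrow>xs. f x) = (\<Prod>x\<leftarrow>xs. norm (f x))"
  by (induction xs) (auto simp: norm_mult)

lemma measurable_I_chi:
  assumes "gamma_branch \<Lambda>"
  shows "(\<lambda>\<tau>. I_chi \<Lambda> m n us ls (\<i> * of_real \<tau>)) \<in> borel_measurable borel"
  unfolding I_chi_def case_prod_unfold
  by (intro borel_measurable_divide borel_measurable_times measurable_prod_list measurable_Gamma_pow assms)

lemma prod_list_inverse:
  fixes f :: "'b \<Rightarrow> real"
  shows "inverse (\<Prod>x\<leftarrow>xs. f x) = (\<Prod>x\<leftarrow>xs. inverse (f x))"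
  by (induction xs) auto

definition I_chi_abs :: "nat \<Rightarrow> nat \<Rightarrow> triple list \<Rightarrow> triple list \<Rightarrow> real \<Rightarrow> real" where
  "I_chi_abs m n us ls \<tau> =
    (\<Prod>x\<leftarrow>take m ls. inverse (rGamma_abs_pow (fst x) (fst (snd x)) (snd (snd x)) \<tau>)) *
    (\<Prod>x\<leftarrow>take n us. inverse (rGamma_abs_pow (1 - fst x) (- fst (snd x)) (snd (snd x)) \<tau>)) *
    ((\<Prod>x\<leftarrow>drop m ls. rGamma_abs_pow (1 - fst x) (- fst (snd x)) (snd (snd x)) \<tau>) *
     (\<Prod>x\<leftarrow>drop n us. rGamma_abs_pow (fst x) (fst (snd x)) (snd (snd x)) \<tau>))"

lemma norm_I_chi:
  assumes "gamma_branch \<Lambda>"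
  shows "norm (I_chi \<Lambda> m n us ls (\<i> * of_real \<tau>)) = I_chi_abs m n us ls \<tau>"
  unfolding I_chi_def I_chi_abs_def case_prod_unfold divide_inverse inverse_mult_distrib norm_mult norm_inverse
    norm_prod_list norm_Gamma_pow[OF assms] prod_list_inverse inverse_inverse_eq ..

text \<open>
  The numerator of \<open>\<chi>\<close> has no pole on the contour, and the denominator enters through reciprocal
  Gamma functions.
\<close>
lemma continuous_I_chi_abs:
  assumes "I_standing m n us ls \<theta>"
  shows "continuous_on UNIV (I_chi_abs m n us ls)"
proof -
  have inv: "continuous_on UNIV (\<lambda>\<tau>. inverse (rGamma_abs_pow c d \<kappa> \<tau>))"
    if "\<kappa> > 0" "\<And>s. c + of_real d * s \<in> \<int>\<^sub>\<le>\<^sub>0 \<Longrightarrow> Re s \<noteq> 0" for c d \<kappa>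
  proof -
    have "c + of_real d * (\<i> * of_real \<tau>) \<notin> \<int>\<^sub>\<le>\<^sub>0" for \<tau>
      using that(2)[of "\<i> * of_real \<tau>"] by auto
    thus ?thesis using that(1)
      by (intro continuous_on_inverse continuous_rGamma_abs_pow) (auto simp: rGamma_abs_pow_def rGamma_eq_zero_iff)
  qed
  have pos_us: "snd (snd x) > 0" if "x \<in> set us" for x
    using assms that unfolding I_standing_def case_prod_unfold by blast
  have pos_ls: "snd (snd x) > 0" if "x \<in> set ls" for x
    using assms that unfolding I_standing_def case_prod_unfold by blast
  have 1: "continuous_on UNIV (\<lambda>\<tau>. inverse (rGamma_abs_pow (fst x) (fst (snd x)) (snd (snd x)) \<tau>))" if x: "x \<in> set (take m ls)" for x
  proof (rule inv)
    show "snd (snd x) > 0" by (rule pos_ls[OF in_set_takeD[OF x]])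
    show "Re s \<noteq> 0" if "fst x + of_real (fst (snd x)) * s \<in> \<int>\<^sub>\<le>\<^sub>0" for s
    proof -
      have "Re s < 0" using assms x that unfolding I_standing_def case_prod_unfold by blast
      thus ?thesis by simp
    qed
  qed
  have 2: "continuous_on UNIV (\<lambda>\<tau>. inverse (rGamma_abs_pow (1 - fst x) (- fst (snd x)) (snd (snd x)) \<tau>))" if x: "x \<in> set (take n us)" for x
  proof (rule inv)
    show "snd (snd x) > 0" by (rule pos_us[OF in_set_takeD[OF x]])
    show "Re s \<noteq> 0" if "1 - fst x + of_real (- fst (snd x)) * s \<in> \<int>\<^sub>\<le>\<^sub>0" for s
    proof -
      have "1 - fst x - of_real (fst (snd x)) * s \<in> \<int>\<^sub>\<le>\<^sub>0" using that by simp
      hence "Re s > 0" using assms x unfolding I_standing_def case_prod_unfold by blast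
      thus ?thesis by simp
    qed
  qed
  show ?thesis unfolding I_chi_abs_def
    by (intro continuous_on_mult continuous_on_prod_list 1 2 continuous_rGamma_abs_pow
         pos_us[OF in_set_dropD] pos_ls[OF in_set_dropD])
qed

lemma sum_list_take_drop:
  fixes f :: "'b \<Rightarrow> real"
  shows "(\<Sum>x\<leftarrow>xs. f x) = (\<Sum>x\<leftarrow>take k xs. f x) + (\<Sum>x\<leftarrow>drop k xs. f x)"
  by (metis append_take_drop_id map_append sum_list_append)

text \<open>
  The definitions of \<open>\<Omega>\<close> and \<open>\<Delta>\<close> collect precisely the exponents that Stirling's formula gives for
  the single factors.
\<close>
lemma I_chi_abs_bigtheta:
  assumes "I_standing m n us ls \<theta>"
  shows "I_chi_abs m n us ls \<in> \<Theta>[at_infinity](exp_growth (I_Omega us ls) (- (pi / 2) * I_Delta m n us ls))"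
proof -
  have pos_us: "fst (snd x) > 0" if "x \<in> set us" for x
    using assms that unfolding I_standing_def case_prod_unfold by blast
  have pos_ls: "fst (snd x) > 0" if "x \<in> set ls" for x
    using assms that unfolding I_standing_def case_prod_unfold by blast
  have num: "(\<lambda>\<tau>. inverse (rGamma_abs_pow c d \<kappa> \<tau>)) \<in> \<Theta>[at_infinity](exp_growth (- (\<kappa> * (1 / 2 - Re c))) (- (pi / 2) * (\<kappa> * \<bar>d\<bar>)))"
    if "d \<noteq> 0" for c d \<kappa>
  proof -
    have "(\<lambda>\<tau>. inverse (rGamma_abs_pow c d \<kappa> \<tau>)) \<in> \<Theta>[at_infinity](\<lambda>\<tau>. inverse (exp_growth (\<kappa> * (1 / 2 - Re c)) (pi / 2 * (\<kappa> * \<bar>d\<bar>)) \<tau>))"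
      using rGamma_abs_pow_bigtheta[OF that] by (simp only: bigtheta_inverse)
    thus ?thesis by (simp only: exp_growth_inverse mult_minus_left)
  qed
  note den = rGamma_abs_pow_bigtheta
  have "I_chi_abs m n us ls \<in> \<Theta>[at_infinity](\<lambda>\<tau>.
     exp_growth (\<Sum>x\<leftarrow>take m ls. - (snd (snd x) * (1 / 2 - Re (fst x)))) (\<Sum>x\<leftarrow>take m ls. - (pi / 2) * (snd (snd x) * \<bar>fst (snd x)\<bar>)) \<tau> *
     exp_growth (\<Sum>x\<leftarrow>take n us. - (snd (snd x) * (1 / 2 - Re (1 - fst x)))) (\<Sum>x\<leftarrow>take n us. - (pi / 2) * (snd (snd x) * \<bar>- fst (snd x)\<bar>)) \<tau> *
     (exp_growth (\<Sum>x\<leftarrow>drop m ls. snd (snd x) * (1 / 2 - Re (1 - fst x))) (\<Sum>x\<leftarrow>drop m ls. pi / 2 * (snd (snd x) * \<bar>- fst (snd x)\<bar>)) \<tau> *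
      exp_growth (\<Sum>x\<leftarrow>drop n us. snd (snd x) * (1 / 2 - Re (fst x))) (\<Sum>x\<leftarrow>drop n us. pi / 2 * (snd (snd x) * \<bar>fst (snd x)\<bar>)) \<tau>))"
    unfolding I_chi_abs_def
  proof (intro landau_theta.mult bigtheta_exp_growth_prod_list num den)
  qed (auto dest!: in_set_takeD in_set_dropD pos_us pos_ls)
  also have "(\<lambda>\<tau>.
     exp_growth (\<Sum>x\<leftarrow>take m ls. - (snd (snd x) * (1 / 2 - Re (fst x)))) (\<Sum>x\<leftarrow>take m ls. - (pi / 2) * (snd (snd x) * \<bar>fst (snd x)\<bar>)) \<tau> *
     exp_growth (\<Sum>x\<leftarrow>take n us. - (snd (snd x) * (1 / 2 - Re (1 - fst x)))) (\<Sum>x\<leftarrow>take n us. - (pi / 2) * (snd (snd x) * \<bar>- fst (snd x)\<bar>)) \<tau> *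
     (exp_growth (\<Sum>x\<leftarrow>drop m ls. snd (snd x) * (1 / 2 - Re (1 - fst x))) (\<Sum>x\<leftarrow>drop m ls. pi / 2 * (snd (snd x) * \<bar>- fst (snd x)\<bar>)) \<tau> *
      exp_growth (\<Sum>x\<leftarrow>drop n us. snd (snd x) * (1 / 2 - Re (fst x))) (\<Sum>x\<leftarrow>drop n us. pi / 2 * (snd (snd x) * \<bar>fst (snd x)\<bar>)) \<tau>)) =
    exp_growth (I_Omega us ls) (- (pi / 2) * I_Delta m n us ls)"
  proof -
    have neg: "(\<Sum>x\<leftarrow>xs. - f x) = - (\<Sum>x\<leftarrow>xs. f x)" for f :: "triple \<Rightarrow> real" and xs
      by (induction xs) auto
    have abs: "(\<Sum>x\<leftarrow>xs. snd (snd x) * \<bar>fst (snd x)\<bar>) = (\<Sum>x\<leftarrow>xs. snd (snd x) * fst (snd x))"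
      if "\<And>x. x \<in> set xs \<Longrightarrow> fst (snd x) > 0" for xs :: "triple list"
      by (intro arg_cong[of _ _ sum_list] map_cong refl) (use that in force)
    have flip: "snd (snd x) * (1 / 2 - Re (1 - fst x)) = - ((1 / 2 - Re (fst x)) * snd (snd x))" for x :: triple
      by (simp add: algebra_simps)
    have abs': "(\<Sum>x\<leftarrow>take m ls. snd (snd x) * \<bar>fst (snd x)\<bar>) = (\<Sum>x\<leftarrow>take m ls. snd (snd x) * fst (snd x))"
      "(\<Sum>x\<leftarrow>drop m ls. snd (snd x) * \<bar>fst (snd x)\<bar>) = (\<Sum>x\<leftarrow>drop m ls. snd (snd x) * fst (snd x))"
      "(\<Sum>x\<leftarrow>take n us. snd (snd x) * \<bar>fst (snd x)\<bar>) = (\<Sum>x\<leftarrow>take n us. snd (snd x) * fst (snd x))"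
      "(\<Sum>x\<leftarrow>drop n us. snd (snd x) * \<bar>fst (snd x)\<bar>) = (\<Sum>x\<leftarrow>drop n us. snd (snd x) * fst (snd x))"
      by (intro abs, blast intro: pos_us pos_ls dest: in_set_takeD in_set_dropD)+
    show ?thesis
      unfolding exp_growth_mult I_Omega_def I_Delta_def case_prod_unfold abs_minus_cancel sum_list_const_mult abs' flip
        minus_minus neg
        sum_list_take_drop[of "\<lambda>x. (1/2 - Re (fst x)) * snd (snd x)" us n]
        sum_list_take_drop[of "\<lambda>x. (1/2 - Re (fst x)) * snd (snd x)" ls m]
      by (intro arg_cong2[of _ _ _ _ exp_growth]) (simp_all add: mult.commute[of "snd (snd _)" "1/2 - _"] algebra_simps)
  qed
  finally show ?thesis .
qed

section \<open>Absolute convergence of the contour integral\<close>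

lemma integrable_of_bigo_powr:
  fixes f :: "real \<Rightarrow> real"
  assumes cont: "continuous_on UNIV f" and O: "f \<in> O[at_infinity](\<lambda>\<tau>. \<bar>\<tau>\<bar> powr p)" and p: "p < -1"
  shows "integrable lborel f"
proof -
  obtain c where c: "\<forall>\<^sub>F \<tau> in at_infinity. norm (f \<tau>) \<le> c * norm (\<bar>\<tau>\<bar> powr p)" "c > 0"
    using O by (elim landau_o.bigE)
  then obtain b where b: "\<And>\<tau>. \<bar>\<tau>\<bar> \<ge> b \<Longrightarrow> \<bar>f \<tau>\<bar> \<le> c * \<bar>\<tau>\<bar> powr p"
    unfolding eventually_at_infinity by auto
  \<comment> \<open>Positive, so that the tails are integrals of \<open>\<tau> powr p\<close> over half-lines away from \<open>0\<close>.\<close>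
  define R where "R = max 1 b"
  have R: "R > 0" "R \<ge> b" by (simp_all add: R_def)
  have "compact (f ` {-R..R})" by (intro compact_continuous_image continuous_on_subset[OF cont]) auto
  hence "bounded (f ` {-R..R})" by (rule compact_imp_bounded)
  then obtain K where "\<forall>y\<in>f ` {-R..R}. norm y \<le> K" unfolding bounded_iff by blast
  hence K: "\<bar>f \<tau>\<bar> \<le> K" if "\<tau> \<in> {-R..R}" for \<tau> using that by simp
  have tail: "integrable lborel (\<lambda>\<tau>. indicator {R..} \<tau> *\<^sub>R (\<tau> powr p))"
    using set_integrable_lborel_if_has_integral_nonneg(1)[OF has_integral_powr_to_inf[OF p R(1)]]
    by (simp add: set_integrable_def)
  have tail': "integrable lborel (\<lambda>\<tau>. indicator {R..} (- \<tau>) *\<^sub>R ((- \<tau>) powr p))"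
    using lborel_integrable_real_affine[OF tail, of "-1" 0] by simp
  have mid: "integrable lborel (\<lambda>\<tau>. indicator {-R..R} \<tau> *\<^sub>R K)"
    by (intro integrable_scaleR_left integrable_real_indicator) (use R in auto)
  define B where "B = (\<lambda>\<tau>. indicator {-R..R} \<tau> *\<^sub>R K + c * (indicator {R..} \<tau> *\<^sub>R (\<tau> powr p)) + c * (indicator {R..} (- \<tau>) *\<^sub>R ((- \<tau>) powr p)))"
  have "integrable lborel B"
    unfolding B_def by (intro Bochner_Integration.integrable_add integrable_mult_right mid tail tail')
  thus ?thesis
  proof (rule Bochner_Integration.integrable_bound)
    show "f \<in> borel_measurable lborel" using borel_measurable_continuous_onI[OF cont] by simp
    have "\<bar>f \<tau>\<bar> \<le> B \<tau>" for \<tau>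
    proof (cases "\<tau> \<in> {-R..R}")
      case True
      have "c * (indicator {R..} y *\<^sub>R (y powr p)) \<ge> 0" for y using c(2) by simp
      from this[of \<tau>] this[of "- \<tau>"] have "K \<le> B \<tau>" using True unfolding B_def by simp
      thus ?thesis using K[OF True] by linarith
    next
      case False
      hence "\<bar>f \<tau>\<bar> \<le> c * \<bar>\<tau>\<bar> powr p" using R by (intro b) auto
      also have "\<dots> = B \<tau>" using False R(1) by (auto simp: B_def indicator_def)
      finally show ?thesis .
    qed
    thus "AE \<tau> in lborel. norm (f \<tau>) \<le> norm (B \<tau>)" by (auto intro!: AE_I2 order_trans[OF _ abs_ge_self])
  qed
qed

lemma filterlim_abs_at_infinity: "filterlim (\<lambda>\<tau>::real. \<bar>\<tau>\<bar>) at_top at_infinity"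
proof -
  have "(norm :: real \<Rightarrow> real) = (\<lambda>\<tau>. \<bar>\<tau>\<bar>)" by (rule ext) simp
  thus ?thesis using filterlim_norm_at_top[where 'a = real] by (simp only:)
qed

text \<open>
  The factor \<open>exp (\<theta> \<tau>)\<close> is the modulus of \<open>z\<^sup>-\<^sup>s\<close> at \<open>s = \<i> \<tau>\<close>. If \<open>|\<theta>|\<close> is below the
  critical angle \<open>\<pi> d / 2\<close>, an exponential decay remains. On the boundary only the power of \<open>|\<tau>|\<close> is left.
\<close>
lemma exp_growth_twist_bigo:
  assumes conv: "(d > 0 \<and> \<bar>\<theta>\<bar> < pi / 2 * d) \<or> (\<bar>\<theta>\<bar> = pi / 2 * d \<and> w < -1)"
  obtains p where "p < -1" "(\<lambda>\<tau>. exp_growth w (- (pi / 2) * d) \<tau> * exp (\<theta> * \<tau>)) \<in> O[at_infinity](\<lambda>\<tau>. \<bar>\<tau>\<bar> powr p)"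
proof -
  have le: "norm (exp_growth w (- (pi / 2) * d) \<tau> * exp (\<theta> * \<tau>)) \<le> 1 * norm (exp_growth w (- (pi / 2 * d - \<bar>\<theta>\<bar>)) \<tau>)" for \<tau>
  proof -
    have "\<theta> * \<tau> \<le> \<bar>\<theta>\<bar> * \<bar>\<tau>\<bar>" unfolding abs_mult[symmetric] by (rule abs_ge_self)
    hence "exp (- (pi / 2) * d * \<bar>\<tau>\<bar>) * exp (\<theta> * \<tau>) \<le> exp (- (pi / 2 * d - \<bar>\<theta>\<bar>) * \<bar>\<tau>\<bar>)"
      unfolding exp_add[symmetric] exp_le_cancel_iff by (simp add: algebra_simps)
    hence "\<bar>\<tau>\<bar> powr w * (exp (- (pi / 2) * d * \<bar>\<tau>\<bar>) * exp (\<theta> * \<tau>)) \<le> \<bar>\<tau>\<bar> powr w * exp (- (pi / 2 * d - \<bar>\<theta>\<bar>) * \<bar>\<tau>\<bar>)"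
      by (rule mult_left_mono) simp
    thus ?thesis unfolding exp_growth_def by (simp add: abs_mult mult.assoc)
  qed
  have bigo: "(\<lambda>\<tau>. exp_growth w (- (pi / 2) * d) \<tau> * exp (\<theta> * \<tau>)) \<in> O[at_infinity](exp_growth w (- (pi / 2 * d - \<bar>\<theta>\<bar>)))"
    by (rule bigoI[OF always_eventually[OF allI[OF le]]])
  show ?thesis
  proof (cases "\<bar>\<theta>\<bar> < pi / 2 * d")
    case True
    define e where "e = pi / 2 * d - \<bar>\<theta>\<bar>"
    have "e > 0" using True by (simp add: e_def)
    hence "(\<lambda>y::real. y powr w * exp (- e * y)) \<in> O(\<lambda>y. y powr (-2))" by real_asymp
    from landau_o.big.compose[OF this filterlim_abs_at_infinity]
    have "exp_growth w (- e) \<in> O[at_infinity](\<lambda>\<tau>. \<bar>\<tau>\<bar> powr (-2))" by (simp add: exp_growth_def[abs_def])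
    with bigo have "(\<lambda>\<tau>. exp_growth w (- (pi / 2) * d) \<tau> * exp (\<theta> * \<tau>)) \<in> O[at_infinity](\<lambda>\<tau>. \<bar>\<tau>\<bar> powr (-2))"
      unfolding e_def by (rule landau_o.big_trans)
    thus ?thesis by (intro that[of "-2"]) auto
  next
    case False
    hence eq: "pi / 2 * d - \<bar>\<theta>\<bar> = 0" and w: "w < -1" using conv by auto
    have "exp_growth w (- 0) = (\<lambda>\<tau>. \<bar>\<tau>\<bar> powr w)" by (simp add: exp_growth_def[abs_def])
    with bigo show ?thesis unfolding eq by (intro that[OF w]) (simp only:)
  qed
qed

text \<open>
  Here \<open>L\<close> is \<open>ln |z|\<close>. It drops out of the modulus of the integrand, which is a continuous function
  of \<open>\<tau>\<close>, so its size at infinity decides.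
\<close>
theorem I_fun_integrand_integrable:
  assumes br: "gamma_branch \<Lambda>" and st: "I_standing m n us ls \<theta>"
  shows "integrable lborel (\<lambda>\<tau>. I_chi \<Lambda> m n us ls (\<i> * of_real \<tau>) *
    exp (- (\<i> * of_real \<tau>) * (of_real L + \<i> * of_real \<theta>)) * \<i>)"
proof -
  let ?w = "I_Omega us ls" and ?d = "I_Delta m n us ls"
  have "(?d > 0 \<and> \<bar>\<theta>\<bar> < pi / 2 * ?d) \<or> (\<bar>\<theta>\<bar> = pi / 2 * ?d \<and> ?w < -1)"
    using st unfolding I_standing_def I_conv_def by auto
  then obtain p where p: "p < -1"
    and tw: "(\<lambda>\<tau>. exp_growth ?w (- (pi / 2) * ?d) \<tau> * exp (\<theta> * \<tau>)) \<in> O[at_infinity](\<lambda>\<tau>. \<bar>\<tau>\<bar> powr p)"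
    by (rule exp_growth_twist_bigo)
  have "I_chi_abs m n us ls \<in> O[at_infinity](exp_growth ?w (- (pi / 2) * ?d))"
    using I_chi_abs_bigtheta[OF st] by (rule bigthetaD1)
  hence "(\<lambda>\<tau>. I_chi_abs m n us ls \<tau> * exp (\<theta> * \<tau>)) \<in> O[at_infinity](\<lambda>\<tau>. exp_growth ?w (- (pi / 2) * ?d) \<tau> * exp (\<theta> * \<tau>))"
    by (rule landau_o.big.mult[OF _ landau_o.big_refl])
  hence O: "(\<lambda>\<tau>. I_chi_abs m n us ls \<tau> * exp (\<theta> * \<tau>)) \<in> O[at_infinity](\<lambda>\<tau>. \<bar>\<tau>\<bar> powr p)"
    using tw by (rule landau_o.big_trans)
  have "continuous_on UNIV (\<lambda>\<tau>. I_chi_abs m n us ls \<tau> * exp (\<theta> * \<tau>))"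
    by (intro continuous_on_mult continuous_I_chi_abs[OF st] continuous_intros)
  hence "integrable lborel (\<lambda>\<tau>. I_chi_abs m n us ls \<tau> * exp (\<theta> * \<tau>))"
    by (rule integrable_of_bigo_powr[OF _ O p])
  thus ?thesis
  proof (rule Bochner_Integration.integrable_bound)
    note [measurable] = measurable_I_chi[OF br]
    show "(\<lambda>\<tau>. I_chi \<Lambda> m n us ls (\<i> * of_real \<tau>) *
       exp (- (\<i> * of_real \<tau>) * (of_real L + \<i> * of_real \<theta>)) * \<i>) \<in> borel_measurable lborel"
      by measurable
    have "norm (exp (- (\<i> * of_real \<tau>) * (of_real L + \<i> * of_real \<theta>))) = exp (\<theta> * \<tau>)" for \<tau>
      by (simp add: norm_exp_eq_Re mult.commute)
    thus "AE \<tau> in lborel. norm (I_chi \<Lambda> m n us ls (\<i> * of_real \<tau>) *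
       exp (- (\<i> * of_real \<tau>) * (of_real L + \<i> * of_real \<theta>)) * \<i>) \<le> norm (I_chi_abs m n us ls \<tau> * exp (\<theta> * \<tau>))"
      unfolding norm_mult norm_I_chi[OF br, symmetric] by (simp add: mult.commute)
  qed
qed

section \<open>Interchange of the integrals\<close>

lemma integrable_prod_unimodular:
  fixes k Y :: "real \<Rightarrow> complex" and E :: "real \<Rightarrow> real \<Rightarrow> complex"
  assumes k: "integrable lborel k" and Y: "integrable lborel Y"
    and E: "(\<lambda>(t, \<tau>). E t \<tau>) \<in> borel_measurable (lborel \<Otimes>\<^sub>M lborel)" and unit: "\<And>t \<tau>. norm (E t \<tau>) = 1"
  shows "integrable (lborel \<Otimes>\<^sub>M lborel) (\<lambda>(t, \<tau>). k t * Y \<tau> * E t \<tau>)"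
proof (rule lborel_pair.Fubini_integrable)
  have [measurable]: "k \<in> borel_measurable lborel" "Y \<in> borel_measurable lborel"
    using k Y by (auto dest: borel_measurable_integrable)
  note E' = E[unfolded case_prod_unfold]
  have "(\<lambda>p. k (fst p)) \<in> borel_measurable (lborel \<Otimes>\<^sub>M lborel)" "(\<lambda>p. Y (snd p)) \<in> borel_measurable (lborel \<Otimes>\<^sub>M lborel)"
    by measurable
  thus "(\<lambda>(t, \<tau>). k t * Y \<tau> * E t \<tau>) \<in> borel_measurable (lborel \<Otimes>\<^sub>M lborel)"
    unfolding case_prod_unfold by (intro borel_measurable_times E')
  have "(\<lambda>t. LINT \<tau>|lborel. norm (case (t, \<tau>) of (t, \<tau>) \<Rightarrow> k t * Y \<tau> * E t \<tau>)) = (\<lambda>t. norm (k t) * (LINT \<tau>|lborel. norm (Y \<tau>)))"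
    by (simp add: norm_mult unit)
  thus "integrable lborel (\<lambda>t. LINT \<tau>|lborel. norm (case (t, \<tau>) of (t, \<tau>) \<Rightarrow> k t * Y \<tau> * E t \<tau>))"
    using k by simp
  have "integrable lborel (\<lambda>\<tau>. k t * Y \<tau> * E t \<tau>)" for t
  proof (rule Bochner_Integration.integrable_bound)
    show "integrable lborel (\<lambda>\<tau>. k t * Y \<tau>)" by (rule integrable_mult_right) (rule Y)
    have "(\<lambda>\<tau>. E t \<tau>) \<in> borel_measurable lborel"
      using measurable_compose[OF measurable_Pair1' E, of t] by simp
    thus "(\<lambda>\<tau>. k t * Y \<tau> * E t \<tau>) \<in> borel_measurable lborel" by measurable
  qed (simp add: norm_mult unit)
  thus "AE t in lborel. integrable lborel (\<lambda>\<tau>. case (t, \<tau>) of (t, \<tau>) \<Rightarrow> k t * Y \<tau> * E t \<tau>)" by simp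
qed

text \<open>
  The new factors are the multiplier by which the Saigo operator acts on powers, with
  \<open>r = \<rho> - \<mu> s\<close> in place of \<open>\<rho>\<close>.
\<close>
lemma I_chi_saigo:
  assumes br: "gamma_branch \<Lambda>" and m: "m \<le> length ls"
  shows "I_chi \<Lambda> m (n + 2) ((1 - \<rho>, \<mu>, 1) # (1 + \<beta> - \<gamma> - \<rho>, \<mu>, 1) # us)
      (ls @ [(1 + \<beta> - \<rho>, \<mu>, 1), (1 - \<alpha> - \<gamma> - \<rho>, \<mu>, 1)]) (\<i> * of_real \<tau>) =
    I_chi \<Lambda> m n us ls (\<i> * of_real \<tau>) *
     (let r = \<rho> - of_real \<mu> * (\<i> * of_real \<tau>) in
       Gamma r * Gamma (r + \<gamma> - \<beta>) * rGamma (r - \<beta>) * rGamma (\<alpha> + \<gamma> + r))"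
proof -
  have eqs: "1 - (1 - \<rho>) + of_real (- \<mu>) * (\<i> * of_real \<tau>) = \<rho> - of_real \<mu> * (\<i> * of_real \<tau>)"
    "1 - (1 + \<beta> - \<gamma> - \<rho>) + of_real (- \<mu>) * (\<i> * of_real \<tau>) = \<rho> - of_real \<mu> * (\<i> * of_real \<tau>) + \<gamma> - \<beta>"
    "1 - (1 + \<beta> - \<rho>) + of_real (- \<mu>) * (\<i> * of_real \<tau>) = \<rho> - of_real \<mu> * (\<i> * of_real \<tau>) - \<beta>"
    "1 - (1 - \<alpha> - \<gamma> - \<rho>) + of_real (- \<mu>) * (\<i> * of_real \<tau>) = \<alpha> + \<gamma> + (\<rho> - of_real \<mu> * (\<i> * of_real \<tau>))"
    by (simp_all add: algebra_simps)
  have lists: "take m (ls @ xs) = take m ls" "drop m (ls @ xs) = drop m ls @ xs" for xs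
    using m by simp_all
  have us: "take (n + 2) (x # y # us) = x # y # take n us" "drop (n + 2) (x # y # us) = drop n us" for x y
    by simp_all
  show ?thesis
    unfolding I_chi_def lists us map_append list.map prod_list.append prod_list.Cons prod_list.Nil prod.case
      Gamma_pow_1[OF br] eqs Let_def
    by (simp add: rGamma_inverse_Gamma divide_inverse inverse_mult_distrib mult_ac)
qed

theorem corollary3p1:
  fixes \<alpha> \<beta> \<gamma> \<rho> a :: complex and \<mu> \<theta> x :: real
    and m n :: nat and us ls :: "triple list" and \<Lambda> :: branch
  defines "us' \<equiv> (1 - \<rho>, \<mu>, 1) # (1 + \<beta> - \<gamma> - \<rho>, \<mu>, 1) # us"
    and "ls' \<equiv> ls @ [(1 + \<beta> - \<rho>, \<mu>, 1), (1 - \<alpha> - \<gamma> - \<rho>, \<mu>, 1)]"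
    and "f \<equiv> (\<lambda>t. of_real t powr (\<rho> - 1) * I_fun \<Lambda> m n us ls (a * of_real (t powr \<mu>)) \<theta>)"
  assumes "a \<noteq> 0" and "is_Arg a \<theta>"
    and "gamma_branch \<Lambda>"
    and "I_standing m n us ls \<theta>"
    and "I_standing m (n + 2) us' ls' \<theta>"
    and "Re \<alpha> > 0" and "\<mu> > 0" and "Re \<rho> > max 0 (Re (\<beta> - \<gamma>))"
    and "x > 0"
  shows "set_integrable lborel {0<..<x} (saigo_integrand \<alpha> \<beta> \<gamma> f x) \<and>
    saigo \<alpha> \<beta> \<gamma> f x =
      of_real x powr (- \<beta> + \<rho> - 1) * I_fun \<Lambda> m (n + 2) us' ls' (a * of_real (x powr \<mu>)) \<theta>"
proof -
  \<comment> \<open>The double integrand is \<open>H t \<tau> = k t * Y \<tau> * E t \<tau>\<close>: \<open>k\<close> carries the kernel and the power of \<open>t\<close>,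
    \<open>Y\<close> the integrand of the \<open>I\<close>-function at \<open>a\<close>, and \<open>E t \<tau>\<close> is \<open>(t\<^sup>\<mu>)\<^sup>-\<^sup>s\<close> at \<open>s = \<i> \<tau>\<close>.\<close>
  define L where "L = ln (cmod a)"
  define r where "r = (\<lambda>\<tau>. \<rho> - of_real \<mu> * (\<i> * of_real \<tau>))"
  define X where "X = (\<lambda>\<tau>. I_chi \<Lambda> m n us ls (\<i> * of_real \<tau>))"
  define Y where "Y = (\<lambda>\<tau>. X \<tau> * exp (- (\<i> * of_real \<tau>) * (of_real L + \<i> * of_real \<theta>)) * \<i>)"
  define E where "E = (\<lambda>t \<tau>. exp (- (\<i> * of_real \<tau>) * of_real (\<mu> * ln t)))"
  define k where "k = (\<lambda>t. indicator {0<..<x} t *\<^sub>R saigo_integrand \<alpha> \<beta> \<gamma> (\<lambda>t. of_real t powr (\<rho> - 1)) x t)"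
  define Q where "Q = (\<lambda>\<tau>. Gamma (r \<tau>) * Gamma (r \<tau> + \<gamma> - \<beta>) * rGamma (r \<tau> - \<beta>) * rGamma (\<alpha> + \<gamma> + r \<tau>))"
  define H where "H = (\<lambda>t \<tau>. k t * Y \<tau> * E t \<tau>)"
  have \<alpha>: "Re \<alpha> > 0" and \<rho>: "Re \<rho> > max 0 (Re (\<beta> - \<gamma>))" and x: "x > 0" and br: "gamma_branch \<Lambda>"
    and st: "I_standing m n us ls \<theta>" and a: "a \<noteq> 0"
    using assms by blast+
  have r: "Re (r \<tau>) > max 0 (Re (\<beta> - \<gamma>))" for \<tau> using \<rho> by (simp add: r_def)
  have m: "m \<le> length ls" using st by (simp add: I_standing_def)

  have E_powr: "E t \<tau> = of_real t powr (r \<tau> - \<rho>)" if "t > 0" for t \<tau>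
    using that by (simp add: E_def r_def powr_def Ln_of_real mult_ac)
  have shift: "exp (- (\<i> * of_real \<tau>) * (of_real (ln (cmod (a * of_real (t powr \<mu>)))) + \<i> * of_real \<theta>)) =
      exp (- (\<i> * of_real \<tau>) * (of_real L + \<i> * of_real \<theta>)) * E t \<tau>" if "t > 0" for t \<tau>
  proof -
    have "ln (cmod (a * of_real (t powr \<mu>))) = L + \<mu> * ln t"
      using a that by (simp add: L_def norm_mult ln_mult ln_powr)
    thus ?thesis unfolding E_def exp_add[symmetric] by (simp add: algebra_simps)
  qed
  have I_fun_eq: "I_fun \<Lambda> m n us ls (a * of_real (t powr \<mu>)) \<theta> = 1 / (2 * of_real pi * \<i>) * (LINT \<tau>|lborel. Y \<tau> * E t \<tau>)"
    if "t > 0" for t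
    unfolding I_fun_def shift[OF that] Y_def X_def by (simp only: mult_ac)

  have Y: "integrable lborel Y"
    unfolding Y_def X_def by (rule I_fun_integrand_integrable[OF br st])
  have k: "integrable lborel k"
    using saigo_kernel_power(1)[OF \<alpha> \<rho> x] by (simp add: k_def set_integrable_def)
  have HI: "integrable (lborel \<Otimes>\<^sub>M lborel) (\<lambda>(t, \<tau>). H t \<tau>)"
    unfolding H_def
  proof (rule integrable_prod_unimodular[OF k Y])
    show "(\<lambda>(t, \<tau>). E t \<tau>) \<in> borel_measurable (lborel \<Otimes>\<^sub>M lborel)"
      unfolding E_def by measurable
    show "norm (E t \<tau>) = 1" for t \<tau> by (simp add: E_def norm_exp_eq_Re)
  qed

  have inner_\<tau>: "(LINT \<tau>|lborel. H t \<tau>) = 2 * of_real pi * \<i> * (indicator {0<..<x} t *\<^sub>R saigo_integrand \<alpha> \<beta> \<gamma> f x t)" for t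
  proof (cases "t \<in> {0<..<x}")
    case True
    have "(LINT \<tau>|lborel. H t \<tau>) = k t * (LINT \<tau>|lborel. Y \<tau> * E t \<tau>)"
      unfolding H_def mult.assoc by (rule integral_mult_right_zero)
    also have "(LINT \<tau>|lborel. Y \<tau> * E t \<tau>) = 2 * of_real pi * \<i> * I_fun \<Lambda> m n us ls (a * of_real (t powr \<mu>)) \<theta>"
      using True by (simp add: I_fun_eq)
    finally show ?thesis using True by (simp add: k_def f_def saigo_integrand_def mult_ac)
  qed (simp add: H_def k_def)
  have "integrable lborel (\<lambda>t. LINT \<tau>|lborel. H t \<tau>)"
    using lborel_pair.integrable_fst'[OF HI] by simp
  hence "integrable lborel (\<lambda>t. 1 / (2 * of_real pi * \<i>) * (LINT \<tau>|lborel. H t \<tau>))"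
    by (rule integrable_mult_right)
  hence int: "set_integrable lborel {0<..<x} (saigo_integrand \<alpha> \<beta> \<gamma> f x)"
    by (simp add: inner_\<tau> set_integrable_def)

  have inner_t: "(LINT t|lborel. H t \<tau>) = Y \<tau> * (of_real x powr (\<alpha> + r \<tau> - 1) * (Gamma \<alpha> * Q \<tau>))" for \<tau>
  proof -
    have "H t \<tau> = Y \<tau> * (indicator {0<..<x} t *\<^sub>R saigo_integrand \<alpha> \<beta> \<gamma> (\<lambda>t. of_real t powr (r \<tau> - 1)) x t)" for t
    proof (cases "t \<in> {0<..<x}")
      case True
      have "of_real t powr (r \<tau> - 1) = of_real t powr (\<rho> - 1) * E t \<tau>"
        using True by (simp add: E_powr flip: powr_add)
      thus ?thesis using True by (simp add: H_def k_def saigo_integrand_def mult_ac)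
    qed (simp add: H_def k_def)
    hence "(LINT t|lborel. H t \<tau>) = Y \<tau> * (LINT t:{0<..<x}|lborel. saigo_integrand \<alpha> \<beta> \<gamma> (\<lambda>t. of_real t powr (r \<tau> - 1)) x t)"
      unfolding set_lebesgue_integral_def by (simp only: integral_mult_right_zero)
    thus ?thesis unfolding saigo_kernel_power(2)[OF \<alpha> r x] by (simp add: Q_def mult_ac)
  qed

  have "2 * of_real pi * \<i> * (LINT t:{0<..<x}|lborel. saigo_integrand \<alpha> \<beta> \<gamma> f x t) = (LINT t|lborel. LINT \<tau>|lborel. H t \<tau>)"
    unfolding inner_\<tau> set_lebesgue_integral_def by (rule integral_mult_right_zero[symmetric])
  also have "\<dots> = (LINT \<tau>|lborel. LINT t|lborel. H t \<tau>)"
    by (rule lborel_pair.Fubini_integral[OF HI, symmetric])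
  also have "\<dots> = (LINT \<tau>|lborel. (Gamma \<alpha> * of_real x powr (\<alpha> + \<rho> - 1)) * (Y \<tau> * Q \<tau> * E x \<tau>))"
  proof -
    have "of_real x powr (\<alpha> + r \<tau> - 1) = of_real x powr (\<alpha> + \<rho> - 1) * E x \<tau>" for \<tau>
      using x by (simp add: E_powr algebra_simps flip: powr_add)
    thus ?thesis unfolding inner_t by (simp only: mult_ac)
  qed
  also have "\<dots> = (Gamma \<alpha> * of_real x powr (\<alpha> + \<rho> - 1)) * (LINT \<tau>|lborel. Y \<tau> * Q \<tau> * E x \<tau>)"
    by (rule integral_mult_right_zero)
  also have "(LINT \<tau>|lborel. Y \<tau> * Q \<tau> * E x \<tau>) = 2 * of_real pi * \<i> * I_fun \<Lambda> m (n + 2) us' ls' (a * of_real (x powr \<mu>)) \<theta>"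
  proof -
    have "I_chi \<Lambda> m (n + 2) us' ls' (\<i> * of_real \<tau>) = X \<tau> * Q \<tau>" for \<tau>
      unfolding us'_def ls'_def I_chi_saigo[OF br m] by (simp add: X_def Q_def r_def Let_def)
    thus ?thesis unfolding I_fun_def shift[OF x] Y_def by (simp add: mult_ac)
  qed
  finally have J: "(LINT t:{0<..<x}|lborel. saigo_integrand \<alpha> \<beta> \<gamma> f x t) =
      Gamma \<alpha> * of_real x powr (\<alpha> + \<rho> - 1) * I_fun \<Lambda> m (n + 2) us' ls' (a * of_real (x powr \<mu>)) \<theta>"
    by simp
  have "Gamma \<alpha> \<noteq> 0" using notin_nonpos_Ints_if_Re_pos[OF \<alpha>] by (simp add: Gamma_eq_zero_iff)
  moreover have "of_real x powr (- \<alpha> - \<beta>) * of_real x powr (\<alpha> + \<rho> - 1) = of_real x powr (- \<beta> + \<rho> - 1)"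
    unfolding powr_add[symmetric] by (simp add: algebra_simps)
  ultimately have "saigo \<alpha> \<beta> \<gamma> f x =
      of_real x powr (- \<beta> + \<rho> - 1) * I_fun \<Lambda> m (n + 2) us' ls' (a * of_real (x powr \<mu>)) \<theta>"
    unfolding saigo_def J by (simp add: field_simps)
  with int show ?thesis by blast
qed

end
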